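(* Let $q\ge 3$ be a prime power and $n\ge 2$. Then each matrix in $M_n(\mathbb F_q)$ is a sum of (a) two invertible cyclic matrices; (b) two invertible semisimple matrices.
   Context: A matrix $A\in M_n(K)$ over a field $K$ is cyclic if its minimal polynomial equals its characteristic polynomial (equivalently, $K^n$ is a cyclic $K[A]$-module). $A$ is semisimple if its minimal polynomial is a product of distinct monic irreducible separable polynomials. *)

theory Defs
  imports
    "HOL-Library.Cardinality"
    "Jordan_Normal_Form.Char_Poly"
    "Berlekamp_Zassenhaus.Poly_Mod"
begin

(* The matrix type does not fix dimensions, so it is not an additive monoid and "sum" is not
   available on it; the polynomial expression p(A) is therefore written entrywise. *)
definition mat_poly_eval :: "'a :: comm_ring_1 poly \<Rightarrow> 'a mat \<Rightarrow> 'a mat" where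
  "mat_poly_eval p A = mat (dim_row A) (dim_row A)
     (\<lambda>(i, j). \<Sum>k\<le>degree p. coeff p k * (A ^\<^sub>m k) $$ (i, j))"

definition is_min_poly :: "'a :: field mat \<Rightarrow> 'a poly \<Rightarrow> bool" where
  "is_min_poly A p \<longleftrightarrow> monic p \<and>
     mat_poly_eval p A = 0\<^sub>m (dim_row A) (dim_row A) \<and>
     (\<forall>r. r \<noteq> 0 \<longrightarrow> mat_poly_eval r A = 0\<^sub>m (dim_row A) (dim_row A) \<longrightarrow> degree p \<le> degree r)"

definition min_poly :: "'a :: field mat \<Rightarrow> 'a poly" where
  "min_poly A = (THE p. is_min_poly A p)"

definition cyclic_mat :: "'a :: field mat \<Rightarrow> bool" where
  "cyclic_mat A \<longleftrightarrow> min_poly A = char_poly A"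

(* The library's "separable f" is coprimality of f and its derivative, i.e. f has no repeated root
   in a splitting field. *)
definition semisimple_mat :: "'a :: field mat \<Rightarrow> bool" where
  "semisimple_mat A \<longleftrightarrow>
     (\<exists>S. finite S \<and> (\<forall>f\<in>S. monic f \<and> irreducible f \<and> separable f) \<and> min_poly A = \<Prod>S)"

lemma mat_poly_eval_dim [simp]:
  "dim_row (mat_poly_eval p A) = dim_row A" "dim_col (mat_poly_eval p A) = dim_row A"
  by (simp_all add: mat_poly_eval_def)

lemma mat_poly_eval_index:
  assumes "i < dim_row A" "j < dim_row A" "degree p \<le> m"
  shows "mat_poly_eval p A $$ (i, j) = (\<Sum>k\<le>m. coeff p k * (A ^\<^sub>m k) $$ (i, j))"
proof -
  have "(\<Sum>k\<le>degree p. coeff p k * (A ^\<^sub>m k) $$ (i, j)) = (\<Sum>k\<le>m. coeff p k * (A ^\<^sub>m k) $$ (i, j))"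
    by (rule sum.mono_neutral_left) (use assms in \<open>auto simp: coeff_eq_0\<close>)
  then show ?thesis using assms by (simp add: mat_poly_eval_def)
qed

lemma mat_poly_eval_zero_iff:
  assumes "degree p \<le> m"
  shows "mat_poly_eval p A = 0\<^sub>m (dim_row A) (dim_row A) \<longleftrightarrow>
    (\<forall>i<dim_row A. \<forall>j<dim_row A. (\<Sum>k\<le>m. coeff p k * (A ^\<^sub>m k) $$ (i, j)) = 0)"
  by (auto simp: mat_eq_iff mat_poly_eval_index[OF _ _ assms])

lemma is_min_poly_unique:
  assumes p: "is_min_poly A p" and r: "is_min_poly A r"
  shows "p = r"
proof (rule ccontr)
  assume "p \<noteq> r"
  define s where "s = p - r"
  have deg: "degree p = degree r"
    using p r unfolding is_min_poly_def by (metis antisym leading_coeff_0_iff zero_neq_one)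
  have s0: "s \<noteq> 0" using \<open>p \<noteq> r\<close> by (simp add: s_def)
  have ds: "degree s \<le> degree p" using deg by (simp add: s_def degree_diff_le)
  have "coeff s (degree p) = 0" using p r deg by (simp add: s_def is_min_poly_def)
  with s0 ds have lt: "degree s < degree p" by (metis le_neq_implies_less leading_coeff_0_iff)
  have "mat_poly_eval s A = 0\<^sub>m (dim_row A) (dim_row A)"
    using p r unfolding is_min_poly_def
    by (subst mat_poly_eval_zero_iff[OF ds])
       (simp add: mat_poly_eval_zero_iff[of _ "degree p"] deg s_def left_diff_distrib sum_subtractf)
  with p s0 have "degree p \<le> degree s" by (simp add: is_min_poly_def)
  with lt show False by simp
qed

lemma is_min_poly_exists:
  fixes A :: "'a :: {field, finite} mat"
  assumes A: "A \<in> carrier_mat n n"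
  shows "\<exists>p. is_min_poly A p"
proof -
  define ann where "ann = (\<lambda>p. p \<noteq> 0 \<and> mat_poly_eval p A = 0\<^sub>m (dim_row A) (dim_row A))"
  have dim: "dim_row A = n" using A by simp
  have fin: "finite (carrier_mat n n :: 'a mat set)"
  proof -
    have "inj_on (\<lambda>B :: 'a mat. restrict (($$) B) ({..<n} \<times> {..<n})) (carrier_mat n n)"
      by (rule inj_onI, rule eq_matI) (auto simp: restrict_def fun_eq_iff, metis+)
    moreover have "(\<lambda>B :: 'a mat. restrict (($$) B) ({..<n} \<times> {..<n})) ` carrier_mat n n
        \<subseteq> PiE ({..<n} \<times> {..<n}) (\<lambda>_. UNIV)"
      by (rule image_subsetI) simp
    moreover have "finite (PiE ({..<n} \<times> {..<n}) (\<lambda>_. UNIV :: 'a set))"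
      by (intro finite_PiE) auto
    ultimately show ?thesis by (meson finite_imageD finite_subset)
  qed
  have "range (\<lambda>k. A ^\<^sub>m k) \<subseteq> carrier_mat n n" using A by auto
  then have "\<not> inj (\<lambda>k. A ^\<^sub>m k)"
    using fin by (meson finite_imageD finite_subset infinite_UNIV_nat)
  then obtain k l :: nat where kl: "k < l" "A ^\<^sub>m k = A ^\<^sub>m l"
    by (auto simp: inj_def) (metis linorder_neqE_nat)
  define g :: "'a poly" where "g = monom 1 l - monom 1 k"
  have "coeff g l = 1" using kl by (simp add: g_def)
  then have g0: "g \<noteq> 0" by auto
  have dg: "degree g \<le> l"
    unfolding g_def using kl by (intro degree_diff_le) (auto simp: degree_monom_eq)
  have "mat_poly_eval g A = 0\<^sub>m (dim_row A) (dim_row A)"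
    using kl by (subst mat_poly_eval_zero_iff[OF dg])
      (simp add: g_def left_diff_distrib sum_subtractf if_distrib[of "\<lambda>x. x * _"] cong: if_cong)
  with g0 have "ann g" by (simp add: ann_def)
  then obtain p where p: "ann p" and min: "\<And>r. ann r \<Longrightarrow> degree p \<le> degree r"
    using ex_has_least_nat[of ann g degree] by blast
  define c where "c = inverse (lead_coeff p)"
  have c0: "c \<noteq> 0" and cp: "c * lead_coeff p = 1" using p by (auto simp: c_def ann_def)
  have dc: "degree (Polynomial.smult c p) = degree p" using c0 by simp
  have "mat_poly_eval (Polynomial.smult c p) A = 0\<^sub>m (dim_row A) (dim_row A)"
    using p unfolding ann_def
    by (subst mat_poly_eval_zero_iff[of _ "degree p"])
       (simp_all add: mat_poly_eval_zero_iff[of _ "degree p"] mult.assoc flip: sum_distrib_left)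
  then have "is_min_poly A (Polynomial.smult c p)"
    unfolding is_min_poly_def using cp dc min by (auto simp: ann_def)
  then show ?thesis ..
qed

lemma is_min_poly_min_poly:
  fixes A :: "'a :: {field, finite} mat"
  assumes "A \<in> carrier_mat n n"
  shows "is_min_poly A (min_poly A)"
  unfolding min_poly_def
  using is_min_poly_exists[OF assms] is_min_poly_unique by (metis theI)

end

theory Submission
  imports Defs
begin

text \<open>
  (a) Write \<open>A = B + C\<close> with \<open>B\<close> upper Hessenberg with ones below the diagonal and \<open>C\<close> lower Hessenberg
  with ones above the diagonal; both are cyclic whatever their diagonals are. Choosing the diagonal of
  \<open>B\<close> from top to bottom, the next leading minors of \<open>B\<close> and \<open>C\<close> are affine in the new entry with
  nonzero slope, so only two of the at least three values are forbidden.

  (b) Over a finite field, the matrices of multiplicative order prime to the characteristic are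
  invertible and semisimple. Sums of two such matrices are stable under direct sums, similarity and
  transposition, so it is enough to treat companion matrices. A companion matrix with coefficients \<open>a\<close>
  is similar to a Hessenberg matrix with subdiagonal \<open>1\<close> and a free vector \<open>u\<close> in the last but one
  column. Splitting \<open>1 = \<beta> + \<gamma>\<close> along the subdiagonal gives two matrices with prescribed separable
  characteristic polynomials \<open>f\<close> and \<open>g\<close> not vanishing at \<open>0\<close>: \<open>u\<close> absorbs all coefficients
  except the trace, and \<open>f\<close>, \<open>g\<close> can be found with given traces and a common second coefficient.
\<close>


section \<open>Separable polynomials over a finite field and the order of X\<close>

lemma separable_imp_square_free_field:
  fixes f :: "'a :: field poly"
  assumes "separable f"
  shows "square_free f"
proof -
  have cop: "algebraic_semidom_class.coprime f (pderiv f)" using assms by (simp add: separable_def)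
  have "f \<noteq> 0"
  proof
    assume "f = 0"
    with cop show False by simp
  qed
  moreover have False if g: "degree g > 0" "g * g dvd f" for g
  proof -
    from g(2) obtain h where h: "f = g * g * h" by (elim dvdE)
    have "g dvd f" unfolding h mult.assoc by (rule dvd_triv_left)
    moreover have "g dvd pderiv f" unfolding h by (simp add: pderiv_mult)
    ultimately have "is_unit g" by (rule algebraic_semidom_class.coprime_common_divisor[OF cop])
    with g(1) show False by (auto simp: is_unit_poly_iff)
  qed
  ultimately show ?thesis by (auto simp: square_free_def)
qed

lemma separable_dvd:
  fixes f g :: "'a :: field poly"
  assumes "separable f" "g dvd f"
  shows "separable g"
proof -
  obtain h where f: "f = g * h" using assms(2) by (elim dvdE)
  have cop: "algebraic_semidom_class.coprime f (pderiv f)" using assms(1) by (simp add: separable_def)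
  show ?thesis unfolding separable_def
  proof (rule algebraic_semidom_class.coprimeI)
    fix c assume "c dvd g" "c dvd pderiv g"
    then have "c dvd f" "c dvd pderiv f" unfolding f pderiv_mult by simp_all
    with cop show "is_unit c" by (rule algebraic_semidom_class.coprime_common_divisor)
  qed
qed

text \<open>Distinct monic irreducible polynomials are pairwise non-associated primes. Hence the new
  factor divides none of the others and must divide the cofactor that remains after they are divided
  out.\<close>

lemma prod_irreducible_dvd:
  fixes S :: "'a :: field poly set"
  assumes "finite S" "\<And>f. f \<in> S \<Longrightarrow> irreducible f \<and> monic f \<and> f dvd h"
  shows "\<Prod>S dvd h"
  using assms
proof (induction S rule: finite_induct)
  case (insert f S)
  then have "\<Prod>S dvd h" by simp
  then obtain k where h: "h = \<Prod>S * k" by (elim dvdE)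
  have f: "prime_elem f" "f dvd h" "monic f" "irreducible f"
    using insert.prems by (auto intro: field_poly_irreducible_imp_prime)
  have nd: "\<not> f dvd g" if "g \<in> S" for g
  proof
    assume "f dvd g"
    have g: "irreducible g" "monic g" using insert.prems that by auto
    from \<open>f dvd g\<close> obtain c where c: "g = f * c" by (elim dvdE)
    have "is_unit c" using irreducibleD[OF g(1) c] irreducible_not_unit[OF f(4)] by blast
    then obtain d where "c = [:d:]" by (metis is_unit_poly_iff)
    moreover from this c g(2) f(3) have "d = 1" by (simp split: if_splits)
    ultimately have "g = f" using c by simp
    with that insert.hyps show False by simp
  qed
  have "\<not> f dvd \<Prod>T" if "T \<subseteq> S" for T
    using finite_subset[OF that insert.hyps(1)] that
  proof (induction T rule: finite_induct)
    case empty
    then show ?case using prime_elem_not_unit[OF f(1)] by simp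
  next
    case (insert g T)
    then have "\<not> f dvd g" "\<not> f dvd \<Prod>T" using nd by auto
    then show ?case using insert.hyps prime_elem_dvd_multD[OF f(1)] by (metis prod.insert)
  qed
  then have "\<not> f dvd \<Prod>S" by simp
  then have "f dvd k" using prime_elem_dvd_multD[OF f(1)] f(2) unfolding h by metis
  then have "f * \<Prod>S dvd k * \<Prod>S" by (rule mult_dvd_mono) simp
  then show ?case using insert.hyps h by (simp add: mult.commute)
qed simp

text \<open>A square-free monic polynomial is a product of distinct monic irreducibles, and each of
  these, being prime, divides the base of the power.\<close>

lemma square_free_dvd_power:
  fixes f h :: "'a :: field poly"
  assumes "monic f" "square_free f" "f dvd h ^ k"
  shows "f dvd h"
proof -
  obtain P where P: "finite P" "f = \<Prod>P" "P \<subseteq> {q. irreducible q \<and> monic q}"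
    using monic_square_free_irreducible_factorization[OF assms(1,2)] by blast
  have "q dvd h" if "q \<in> P" for q
  proof -
    have "q dvd f" using dvd_prodI[of P q "\<lambda>q. q"] P that by simp
    moreover have "prime_elem q" using P that field_poly_irreducible_imp_prime by auto
    ultimately show ?thesis using assms(3) by (meson dvd_trans prime_elem_dvd_power)
  qed
  with P show ?thesis by (auto intro!: prod_irreducible_dvd)
qed

lemma prime_CHAR_finite_field: "prime CHAR('a :: {field, finite})"
  by (intro prime_CHAR_semidom finite_imp_CHAR_pos) auto

lemma finite_degree_less: "finite {p :: 'a :: {zero, finite} poly. degree p < n}"
proof -
  have "{p :: 'a poly. degree p < n} \<subseteq> Poly ` {xs. set xs \<subseteq> UNIV \<and> length xs \<le> n}"
  proof
    fix p :: "'a poly" assume "p \<in> {p. degree p < n}"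
    then have "length (coeffs p) \<le> n" by (auto simp: length_coeffs_degree coeffs_def)
    then show "p \<in> Poly ` {xs. set xs \<subseteq> UNIV \<and> length xs \<le> n}"
      by (intro image_eqI[of _ _ "coeffs p"]) auto
  qed
  then show ?thesis by (rule finite_subset) (intro finite_imageI finite_lists_length_le finite)
qed

text \<open>Not vanishing at 0 means being prime to X: if X times a polynomial equals
  \<open>f * d\<close>, then \<open>d\<close> vanishes at 0, so one factor X cancels at a
  time.\<close>

lemma dvd_monom_mult_cancel:
  fixes f q :: "'a :: field poly"
  assumes "poly f 0 \<noteq> 0" "f dvd monom 1 k * q"
  shows "f dvd q"
  using assms(2)
proof (induction k)
  case (Suc k)
  then have "f dvd [:0, 1:] * (monom 1 k * q)" by (simp add: monom_Suc)
  then obtain d where d: "[:0, 1:] * (monom 1 k * q) = f * d" by (elim dvdE)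
  then have "poly d 0 = 0" using assms(1) by (metis mult_eq_0_iff poly_mult mult_zero_left poly_pCons add.right_neutral)
  then obtain e where "d = [:0, 1:] * e" by (metis poly_eq_0_iff_dvd minus_zero dvdE)
  with d have "[:0, 1:] * (monom 1 k * q) = [:0, 1:] * (f * e)" by (simp add: ac_simps)
  then have "monom 1 k * q = f * e" by (subst (asm) mult_left_cancel) auto
  then show ?case using Suc.IH by simp
qed simp

text \<open>X has finite multiplicative order modulo \<open>f\<close>, and square-freeness allows
  the p-part of an exponent to be dropped. The exponent found here becomes the one demanded by
  \<open>tame_mat\<close>.\<close>

lemma separable_dvd_X_power_minus_one:
  fixes f :: "'a :: {field, finite} poly"
  assumes f: "monic f" "separable f" "poly f 0 \<noteq> 0" and deg: "degree f > 0"
  shows "\<exists>N. of_nat N \<noteq> (0 :: 'a) \<and> f dvd monom 1 N - 1"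
proof -
  let ?p = "CHAR('a)"
  have p: "prime ?p" by (rule prime_CHAR_finite_field)
  have f0: "f \<noteq> 0" using f by auto
  \<comment> \<open>Pigeonhole: modulo \<open>f\<close> there are finitely many residues, so two
    powers of X agree, and the common power of X cancels.\<close>
  have "range (\<lambda>k. monom 1 k mod f) \<subseteq> {q. degree q < degree f}"
    using degree_mod_less'[of f] deg f0 by (auto, metis degree_0)
  then have "finite (range (\<lambda>k. monom 1 k mod f))"
    using finite_degree_less by (rule finite_subset)
  then have "\<not> inj (\<lambda>k. monom 1 k mod f)"
    using finite_imageD infinite_UNIV_nat by blast
  then obtain k l :: nat where kl: "k < l" "monom 1 k mod f = monom 1 l mod f"
    unfolding inj_def by (metis linorder_neqE_nat)
  have "f dvd monom 1 l - monom 1 k" using kl(2)[symmetric] by (simp add: mod_eq_dvd_iff)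
  also have "monom 1 l - monom 1 k = monom 1 k * (monom 1 (l - k) - 1 :: 'a poly)"
    using kl by (simp add: right_diff_distrib mult_monom)
  finally have "f dvd monom 1 (l - k) - 1" using f(3) by (rule dvd_monom_mult_cancel[rotated])
  then obtain M :: nat where M: "M > 0" "f dvd monom 1 M - 1" using kl by (metis zero_less_diff)
  obtain e m where em: "M = ?p ^ e * m" "\<not> ?p dvd m"
    using multiplicity_decompose'[of M ?p] M(1) p not_prime_unit by (metis less_numeral_extra(3))
  \<comment> \<open>Frobenius in characteristic p: X^(p^e m) - 1 is the p^e-th power of X^m -
    1.\<close>
  have "monom 1 M - 1 = (monom 1 m - 1 :: 'a poly) ^ (?p ^ e)"
  proof -
    have "((monom 1 m - 1) + 1 :: 'a poly) ^ (?p ^ e) = (monom 1 m - 1) ^ (?p ^ e) + 1 ^ (?p ^ e)"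
      by (rule freshmans_dream') (use p in auto)
    moreover have "(monom 1 m :: 'a poly) ^ (?p ^ e) = monom 1 M"
      by (simp add: monom_power em mult.commute)
    ultimately show ?thesis by simp
  qed
  then have "f dvd monom 1 m - 1"
    using square_free_dvd_power[OF f(1) separable_imp_square_free_field[OF f(2)]] M by metis
  moreover have "of_nat m \<noteq> (0 :: 'a)" using em by (simp add: of_nat_eq_0_iff_char_dvd)
  ultimately show ?thesis by blast
qed


section \<open>Separable polynomials with two prescribed coefficients\<close>

text \<open>A common divisor of \<open>f\<close> and its derivative is prime to X, hence divides
  \<open>[:b, a:]\<close>. This is a nonzero constant if \<open>a = 0\<close>; otherwise its only
  root is not a root of \<open>f\<close>.\<close>

lemma separable_of_pderiv_monom_mult_linear:
  fixes f :: "'a :: field poly"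
  assumes f: "poly f 0 \<noteq> 0" "pderiv f = monom 1 k * [:b, a:]"
    and ab: "a = 0 \<Longrightarrow> b \<noteq> 0" "a \<noteq> 0 \<Longrightarrow> poly f (- b / a) \<noteq> 0"
  shows "separable f"
  unfolding separable_def
proof (rule algebraic_semidom_class.coprimeI)
  fix c assume c: "c dvd f" "c dvd pderiv f"
  from c(1) obtain d where d: "f = c * d" by (elim dvdE)
  have "poly c 0 \<noteq> 0" using f(1) d by auto
  then have "c dvd [:b, a:]" using c(2) unfolding f(2) by (rule dvd_monom_mult_cancel)
  then obtain e where e: "[:b, a:] = c * e" by (elim dvdE)
  have e0: "c \<noteq> 0" "e \<noteq> 0" using e ab by auto
  show "is_unit c"
  proof (cases "a = 0")
    case True
    then have "degree c + degree e = 0" using arg_cong[OF e, of degree] degree_mult_eq[OF e0] by simp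
    then show ?thesis using e0 by (simp add: is_unit_iff_degree)
  next
    case False
    have deg: "degree c + degree e = 1"
      using arg_cong[OF e, of degree] degree_mult_eq[OF e0] False by simp
    have "poly [:b, a:] (- b / a) = 0" using False by simp
    then have "poly c (- b / a) = 0 \<or> poly e (- b / a) = 0" unfolding e by simp
    moreover have "poly c (- b / a) \<noteq> 0" using ab(2)[OF False] d by auto
    ultimately have "degree e \<noteq> 0" using e0 by (metis degree_eq_zeroE poly_const_conv pCons_0_0)
    then show ?thesis using deg e0 by (simp add: is_unit_iff_degree)
  qed
qed

lemma exists_not_in_two:
  assumes "CARD('a :: finite) \<ge> 3"
  shows "\<exists>v :: 'a. v \<noteq> a \<and> v \<noteq> b"
proof (rule ccontr)
  assume "\<not> ?thesis"
  then have "UNIV \<subseteq> {a, b}" by auto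
  then have "CARD('a) \<le> card {a, b}" by (intro card_mono) auto
  also have "\<dots> \<le> 2" by (simp add: card_insert_if)
  finally show False using assms by simp
qed

text \<open>Squaring identifies 1 and -1, so on a finite field it is not injective and therefore not
  surjective.\<close>

lemma exists_nonsquare:
  assumes "(2 :: 'a :: {field, finite}) \<noteq> 0"
  shows "\<exists>e :: 'a. \<forall>t. t\<^sup>2 \<noteq> e"
proof (rule ccontr)
  assume "\<not> ?thesis"
  then have "surj (\<lambda>t :: 'a. t\<^sup>2)" by (metis surj_def)
  then have "inj (\<lambda>t :: 'a. t\<^sup>2)" by (simp add: finite_UNIV_surj_inj)
  then have "(1 :: 'a) = - 1" by (rule injD) simp
  then have "(1 :: 'a) + 1 = 0" by (metis add.right_inverse)
  then show False using assms by simp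
qed

text \<open>In every case the derivative is a power of X times a polynomial of degree at most 1. A
  single \<open>e\<close> has to serve all \<open>t\<close>, because in the application
  \<open>t\<close> is computed from \<open>e\<close>. For n = 2 in characteristic 2 this is
  impossible: at \<open>t = 0\<close> the derivative vanishes.\<close>

lemma exists_separable_two_coeffs:
  assumes q: "CARD('a :: {field, finite}) \<ge> 3"
    and n: "n \<ge> 2" "n = 2 \<Longrightarrow> (2 :: 'a) \<noteq> 0"
  shows "\<exists>e :: 'a. \<forall>t. \<exists>f. monic f \<and> degree f = n \<and> separable f \<and> poly f 0 \<noteq> 0 \<and>
    coeff f (n - 1) = t \<and> coeff f (n - 2) = e"
proof -
  let ?ok = "\<lambda>e t f. monic f \<and> degree f = n \<and> separable f \<and> poly f 0 \<noteq> 0 \<and>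
    coeff f (n - 1) = t \<and> coeff f (n - 2) = (e :: 'a)"
  consider "n = 2" | "n = 3" "(3 :: 'a) = 0" | "n \<ge> 3" "of_nat n \<noteq> (0 :: 'a)"
    | "n \<ge> 4" "of_nat n = (0 :: 'a)"
  proof -
    have "n = 2 \<or> n = 3 \<or> n \<ge> 4" using n(1) by linarith
    moreover have "thesis" if "n = 3" using that \<open>\<lbrakk>n = 3; 3 = 0\<rbrakk> \<Longrightarrow> thesis\<close> \<open>\<lbrakk>n \<ge> 3; of_nat n \<noteq> 0\<rbrakk> \<Longrightarrow> thesis\<close>
      by (cases "(3 :: 'a) = 0") auto
    moreover have "thesis" if "n \<ge> 4" using that \<open>\<lbrakk>n \<ge> 4; of_nat n = 0\<rbrakk> \<Longrightarrow> thesis\<close> \<open>\<lbrakk>n \<ge> 3; of_nat n \<noteq> 0\<rbrakk> \<Longrightarrow> thesis\<close>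
      by (cases "of_nat n = (0 :: 'a)") auto
    ultimately show thesis using that(1) by blast
  qed
  then show ?thesis
  proof cases
    case 1
    have 2: "(2 :: 'a) \<noteq> 0" using n 1 by simp
    have 4: "(4 :: 'a) \<noteq> 0" using 2 by (metis mult_2 numeral_Bit0 mult_eq_0_iff)
    obtain e where e: "\<And>t :: 'a. t\<^sup>2 \<noteq> e" using exists_nonsquare[OF 2] by blast
    have "?ok (e / 4) t [:e / 4, t, 1:]" for t
    proof -
      \<comment> \<open>The value at the critical point is minus a quarter of the discriminant
        \<open>t^2 - e\<close>, which is nonzero because \<open>e\<close> is not a square.\<close>
      have "poly [:e / 4, t, 1:] (- t / 2) = (e - t\<^sup>2) / 4"
        using 2 4 by (simp add: field_simps power2_eq_square)
      then have "poly [:e / 4, t, 1:] (- t / 2) \<noteq> 0" using e[of t] 4 by (metis divide_eq_0_iff eq_iff_diff_eq_0)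
      moreover have "e / 4 \<noteq> 0" using e[of 0] 4 by simp
      ultimately have "separable [:e / 4, t, 1:]"
        by (intro separable_of_pderiv_monom_mult_linear[where k = 0 and a = 2 and b = t])
          (use 2 in \<open>auto simp: pderiv_pCons numeral_poly\<close>)
      with \<open>e / 4 \<noteq> 0\<close> 1 show ?thesis by (simp add: numeral_2_eq_2)
    qed
    then show ?thesis by blast
  next
    case 2
    have "\<exists>f. ?ok 1 t f" for t
    proof -
      \<comment> \<open>In characteristic 3 the derivative of X^3 + tX^2 + X + v is 2tX + 1,
        whatever \<open>v\<close> is, so \<open>v\<close> only has to avoid roots at 0 and at the
        zero of the derivative. For \<open>t = 0\<close> the quotient is 0 by convention and the
        derivative is the constant 1.\<close>
      obtain v where v: "v \<noteq> 0" "v \<noteq> - poly [:0, 1, t, 1:] (- 1 / (2 * t))"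
        using exists_not_in_two[OF q] by blast
      have "(3 :: 'a poly) = 0" using 2 by (simp add: numeral_poly)
      then have "separable [:v, 1, t, 1:]"
        by (intro separable_of_pderiv_monom_mult_linear[where k = 0 and a = "2 * t" and b = 1])
          (use v 2 in \<open>auto simp: pderiv_pCons eq_neg_iff_add_eq_0 power_0_left\<close>)
      then have "?ok 1 t [:v, 1, t, 1:]" using v 2 by (simp add: numeral_2_eq_2 numeral_3_eq_3)
      then show ?thesis by blast
    qed
    then show ?thesis by blast
  next
    case 3
    have "\<exists>f. ?ok 0 t f" for t
    proof -
      \<comment> \<open>The derivative of X^n + tX^(n-1) + v is X^(n-2) (nX + (n-1)t), so again only
        the constant term needs to be adjusted.\<close>
      define g :: "'a poly" where "g = monom 1 n + monom t (n - 1)"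
      obtain v where v: "v \<noteq> 0" "v \<noteq> - poly g (- (of_nat (n - 1) * t) / of_nat n)"
        using exists_not_in_two[OF q] by blast
      define f where "f = g + [:v:]"
      have f0: "poly f 0 \<noteq> 0" using v 3 by (simp add: f_def g_def poly_monom power_0_left)
      have "pderiv f = monom 1 (n - 2) * [:of_nat (n - 1) * t, of_nat n:]"
      proof -
        obtain m where m: "n = Suc (Suc m)" using 3 by (metis add_2_eq_Suc le_Suc_ex n(1))
        have "monom (1 :: 'a) m * [:b, a:] = monom b m + monom a (Suc m)" for a b
        proof -
          have "[:b, a:] = monom b 0 + monom a 1" by (simp add: monom_altdef)
          then show ?thesis by (simp add: distrib_left mult_monom)
        qed
        then show ?thesis
          by (simp add: f_def g_def m pderiv_add pderiv_monom pderiv_pCons add.commute del: of_nat_Suc)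
      qed
      then have "separable f"
        by (rule separable_of_pderiv_monom_mult_linear[OF f0])
          (use v 3 in \<open>auto simp: f_def eq_neg_iff_add_eq_0 add.commute\<close>)
      moreover have c: "coeff f k = (if k = n then 1 else if k = n - 1 then t else if k = 0 then v else 0)" for k
        using 3 by (auto simp: f_def g_def coeff_pCons split: nat.splits)
      moreover have "degree f = n"
        by (rule antisym) (use 3 in \<open>auto intro!: degree_le le_degree simp: c\<close>)
      ultimately have "?ok 0 t f" using f0 3 by auto
      then show ?thesis by blast
    qed
    then show ?thesis by blast
  next
    case 4
    have n1: "of_nat (n - 1) = (- 1 :: 'a)" using 4 by (simp add: of_nat_diff)
    have "\<exists>f. ?ok 0 t f" for t
    proof -
      \<comment> \<open>Here n is 0 in the field, so X^n + tX^(n-1) + sX + 1 has derivative s -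
        tX^(n-2), and s rescues the case \<open>t = 0\<close>. Since n is at least 4, the term sX
        leaves the coefficient of X^(n-2) equal to 0.\<close>
      define s :: 'a where "s = (if t = 0 then 1 else 0)"
      define f where "f = monom 1 n + monom t (n - 1) + monom s 1 + [:1:]"
      have f0: "poly f 0 \<noteq> 0" using 4 by (simp add: f_def poly_monom power_0_left)
      have "pderiv f = monom 1 (if t = 0 then 0 else n - 2) * [:if t = 0 then 1 else - t, 0:]"
        using 4 n1 by (simp add: f_def s_def pderiv_add pderiv_monom pderiv_pCons smult_monom diff_diff_left numeral_2_eq_2)
      then have "separable f"
        by (rule separable_of_pderiv_monom_mult_linear[OF f0]) auto
      moreover have c: "coeff f k = (if k = n then 1 else if k = n - 1 then t else if k = 1 then s else if k = 0 then 1 else 0)" for k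
        using 4 by (auto simp: f_def coeff_pCons split: nat.splits)
      moreover have "degree f = n"
        by (rule antisym) (use 4 in \<open>auto intro!: degree_le le_degree simp: c\<close>)
      ultimately have "?ok 0 t f" using f0 4 by auto
      then show ?thesis by blast
    qed
    then show ?thesis by blast
  qed
qed


section \<open>Polynomials in a matrix, Cayley-Hamilton and a criterion for cyclicity\<close>

lemma pow_mat_Suc_left:
  assumes "A \<in> carrier_mat n n"
  shows "A ^\<^sub>m Suc k = A * A ^\<^sub>m k"
proof (induction k)
  case (Suc k)
  have "A ^\<^sub>m Suc (Suc k) = (A * A ^\<^sub>m k) * A" using Suc by simp
  also have "\<dots> = A * A ^\<^sub>m Suc k" using assms by (simp add: assoc_mult_mat[of _ n n _ n _ n])
  finally show ?case .
qed (use assms in simp)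

lemma index_mult_mat_sum:
  assumes "i < n" "j < m" "A \<in> carrier_mat n l" "B \<in> carrier_mat l m"
  shows "(A * B) $$ (i, j) = (\<Sum>k<l. A $$ (i, k) * B $$ (k, j))"
  using assms by (simp add: scalar_prod_def atLeast0LessThan)

lemma mat_poly_eval_add:
  "mat_poly_eval (p + q) A = mat_poly_eval p A + mat_poly_eval q A"
proof (rule eq_matI)
  fix i j assume ij: "i < dim_row (mat_poly_eval p A + mat_poly_eval q A)"
    "j < dim_col (mat_poly_eval p A + mat_poly_eval q A)"
  define m where "m = max (degree p) (degree q)"
  have "degree (p + q) \<le> m" "degree p \<le> m" "degree q \<le> m"
    by (auto simp: m_def intro: degree_add_le)
  then show "mat_poly_eval (p + q) A $$ (i, j) = (mat_poly_eval p A + mat_poly_eval q A) $$ (i, j)"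
    using ij by (simp add: mat_poly_eval_index[of _ _ _ _ m] sum.distrib distrib_right)
qed auto

lemma mat_poly_eval_smult: "mat_poly_eval (Polynomial.smult c p) A = c \<cdot>\<^sub>m mat_poly_eval p A"
proof (rule eq_matI)
  fix i j assume "i < dim_row (c \<cdot>\<^sub>m mat_poly_eval p A)" "j < dim_col (c \<cdot>\<^sub>m mat_poly_eval p A)"
  then show "mat_poly_eval (Polynomial.smult c p) A $$ (i, j) = (c \<cdot>\<^sub>m mat_poly_eval p A) $$ (i, j)"
    by (simp add: mat_poly_eval_index[of _ _ _ _ "degree p"] sum_distrib_left mult.assoc degree_smult_le)
qed auto

lemma mat_poly_eval_pCons_0:
  assumes A: "A \<in> carrier_mat n n"
  shows "mat_poly_eval (pCons 0 p) A = A * mat_poly_eval p A"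
proof (rule eq_matI)
  fix i j assume "i < dim_row (A * mat_poly_eval p A)" "j < dim_col (A * mat_poly_eval p A)"
  then have ij: "i < n" "j < n" using A by auto
  have e: "mat_poly_eval p A \<in> carrier_mat n n" using A by (intro carrier_matI) auto
  have "mat_poly_eval (pCons 0 p) A $$ (i, j) = (\<Sum>k\<le>Suc (degree p). coeff (pCons 0 p) k * (A ^\<^sub>m k) $$ (i, j))"
    by (rule mat_poly_eval_index) (use ij A in \<open>auto simp: degree_pCons_le\<close>)
  also have "\<dots> = (\<Sum>k\<le>degree p. coeff p k * (A ^\<^sub>m Suc k) $$ (i, j))"
    by (subst sum.atMost_Suc_shift) simp
  also have "\<dots> = (\<Sum>k\<le>degree p. coeff p k * (\<Sum>l<n. A $$ (i, l) * (A ^\<^sub>m k) $$ (l, j)))"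
    unfolding pow_mat_Suc_left[OF A]
    by (intro sum.cong refl arg_cong[of _ _ "(*) _"] index_mult_mat_sum[where n = n and m = n]) (use A ij in auto)
  also have "\<dots> = (\<Sum>l<n. A $$ (i, l) * (\<Sum>k\<le>degree p. coeff p k * (A ^\<^sub>m k) $$ (l, j)))"
    unfolding sum_distrib_left by (subst sum.swap) (simp add: mult_ac)
  also have "\<dots> = (\<Sum>l<n. A $$ (i, l) * mat_poly_eval p A $$ (l, j))"
    by (intro sum.cong refl arg_cong[of _ _ "(*) _"]) (use A ij in \<open>simp add: mat_poly_eval_index[of _ _ _ _ "degree p"]\<close>)
  also have "\<dots> = (A * mat_poly_eval p A) $$ (i, j)"
    by (rule index_mult_mat_sum[symmetric]) (use A ij e in auto)
  finally show "mat_poly_eval (pCons 0 p) A $$ (i, j) = (A * mat_poly_eval p A) $$ (i, j)" .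
qed (use A in auto)

lemma mat_poly_eval_mult_eq_0:
  assumes A: "A \<in> carrier_mat n n" and p: "mat_poly_eval p A = 0\<^sub>m n n"
  shows "mat_poly_eval (q * p) A = 0\<^sub>m n n"
proof (induction q)
  case 0
  show ?case using mat_poly_eval_smult[of 0 p A] p by simp
next
  case (pCons c q)
  then show ?case using A p
    by (simp add: mat_poly_eval_add mat_poly_eval_smult mat_poly_eval_pCons_0)
qed

lemma min_poly_dvd:
  fixes A :: "'a :: {field, finite} mat"
  assumes A: "A \<in> carrier_mat n n" and p: "mat_poly_eval p A = 0\<^sub>m n n"
  shows "min_poly A dvd p"
proof -
  let ?m = "min_poly A"
  have m: "monic ?m" "mat_poly_eval ?m A = 0\<^sub>m n n"
    "\<And>r. r \<noteq> 0 \<Longrightarrow> mat_poly_eval r A = 0\<^sub>m n n \<Longrightarrow> degree ?m \<le> degree r"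
    using is_min_poly_min_poly[OF A] A by (auto simp: is_min_poly_def)
  have "p mod ?m = p + (- (p div ?m)) * ?m" by (simp add: minus_div_mult_eq_mod[symmetric])
  then have "mat_poly_eval (p mod ?m) A = 0\<^sub>m n n"
    using p mat_poly_eval_mult_eq_0[OF A m(2), of "- (p div ?m)"]
    by (simp only: mat_poly_eval_add) simp
  then have "p mod ?m = 0"
    using m(1) m(3)[of "p mod ?m"] degree_mod_less'[of ?m p] by (metis leD lead_coeff_monom monom_eq_0_iff leading_coeff_0_iff zero_neq_one)
  then show ?thesis by auto
qed

text \<open>Comparing coefficients of X^k in (X - A) adj(X - A) = chi * 1 gives N_k - A N_(k+1) =
  c_k * 1. Multiplied by A^k and summed over k, the left-hand sides telescope to 0.\<close>

lemma cayley_hamilton: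
  fixes A :: "'a :: field mat"
  assumes A: "A \<in> carrier_mat n n"
  shows "mat_poly_eval (char_poly A) A = 0\<^sub>m n n"
proof -
  let ?c = "coeff (char_poly A)"
  let ?X = "char_poly_matrix A"
  have X: "?X \<in> carrier_mat n n" using A by simp
  define J where "J = adj_mat ?X"
  have J: "J \<in> carrier_mat n n" "?X * J = char_poly A \<cdot>\<^sub>m 1\<^sub>m n"
    using adj_mat[OF X] by (auto simp: J_def char_poly_def)
  \<comment> \<open>\<open>N k\<close> collects the coefficients of X^(k-1) in the adjugate; the
    shift by one, with \<open>N 0\<close> zero, lets multiplication by X be read off without a
    special case.\<close>
  define N where "N k = mat n n (\<lambda>(i, j). if k = 0 then 0 else coeff (J $$ (i, j)) (k - 1))" for k :: nat
  have N: "N k \<in> carrier_mat n n" for k by (simp add: N_def)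
  have step: "N k $$ (i, j) - (\<Sum>l<n. A $$ (i, l) * N (Suc k) $$ (l, j)) = (if i = j then ?c k else 0)"
    if ij: "i < n" "j < n" for i j k
  proof -
    have "(\<Sum>l<n. ?X $$ (i, l) * J $$ (l, j)) = (if i = j then char_poly A else 0)"
      using index_mult_mat_sum[OF ij X J(1)] ij unfolding J(2) by (simp split: if_splits)
    moreover have "?X $$ (i, l) = (if l = i then [:0, 1:] else 0) + [:- (A $$ (i, l)):]" if "l < n" for l
      using A ij that by (auto simp: char_poly_matrix_def)
    ultimately have "(\<Sum>l<n. (if l = i then [:0, 1:] * J $$ (l, j) else 0) - Polynomial.smult (A $$ (i, l)) (J $$ (l, j)))
      = (if i = j then char_poly A else 0)"
      by (simp add: distrib_right if_distrib[of "\<lambda>x. x * _"] cong: if_cong)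
    then have "[:0, 1:] * J $$ (i, j) - (\<Sum>l<n. Polynomial.smult (A $$ (i, l)) (J $$ (l, j)))
      = (if i = j then char_poly A else 0)"
      using ij by (simp add: sum_subtractf)
    from arg_cong[OF this, of "\<lambda>p. coeff p k"] show ?thesis
      using ij by (cases k) (auto simp: N_def coeff_sum)
  qed
  \<comment> \<open>Large enough that the last telescoping term, built from the coefficients of X^m
    in the adjugate, vanishes.\<close>
  define m where "m = Suc (Max (insert (degree (char_poly A)) ((\<lambda>(i, j). degree (J $$ (i, j))) ` ({..<n} \<times> {..<n}))))"
  have dm: "degree (char_poly A) \<le> m" and dJ: "\<And>i j. i < n \<Longrightarrow> j < n \<Longrightarrow> degree (J $$ (i, j)) < m"
    unfolding m_def by (auto simp: less_Suc_eq_le intro!: Max_ge le_SucI)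
  have "(\<Sum>k\<le>m. ?c k * (A ^\<^sub>m k) $$ (h, j)) = 0" if hj: "h < n" "j < n" for h j
  proof -
    have "?c k * (A ^\<^sub>m k) $$ (h, j) = (A ^\<^sub>m k * N k) $$ (h, j) - (A ^\<^sub>m Suc k * N (Suc k)) $$ (h, j)" for k
    proof -
      have "A ^\<^sub>m Suc k * N (Suc k) = A ^\<^sub>m k * (A * N (Suc k))"
        using A N by (simp add: assoc_mult_mat[of _ n n _ n _ n])
      moreover have AN: "A * N (Suc k) \<in> carrier_mat n n" "A ^\<^sub>m k \<in> carrier_mat n n" using A N by auto
      ultimately have "(A ^\<^sub>m k * N k) $$ (h, j) - (A ^\<^sub>m Suc k * N (Suc k)) $$ (h, j) =
        (\<Sum>i<n. (A ^\<^sub>m k) $$ (h, i) * (N k $$ (i, j) - (A * N (Suc k)) $$ (i, j)))"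
        using hj index_mult_mat_sum[OF hj AN(2) N[of k]] index_mult_mat_sum[OF hj AN(2,1)]
        by (simp add: sum_subtractf right_diff_distrib)
      also have "\<dots> = (\<Sum>i<n. (A ^\<^sub>m k) $$ (h, i) * (if i = j then ?c k else 0))"
        by (intro sum.cong refl) (use step hj index_mult_mat_sum[OF _ hj(2) A N] in simp)
      also have "\<dots> = ?c k * (A ^\<^sub>m k) $$ (h, j)"
        using hj by (simp add: if_distrib[of "\<lambda>x. _ * x"] mult.commute cong: if_cong)
      finally show ?thesis by simp
    qed
    then have "(\<Sum>k\<le>m. ?c k * (A ^\<^sub>m k) $$ (h, j)) = (A ^\<^sub>m 0 * N 0) $$ (h, j) - (A ^\<^sub>m Suc m * N (Suc m)) $$ (h, j)"
      using sum_telescope[of "\<lambda>k. (A ^\<^sub>m k * N k) $$ (h, j)" m] by (simp only:)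
    moreover have "N 0 = 0\<^sub>m n n" by (rule eq_matI) (auto simp: N_def)
    moreover have "N (Suc m) = 0\<^sub>m n n" by (rule eq_matI) (auto simp: N_def dJ coeff_eq_0)
    ultimately show ?thesis using A hj by simp
  qed
  then show ?thesis using mat_poly_eval_zero_iff[OF dm, of A] A by simp
qed

text \<open>The hypothesis gives each power below n an entry in which it is the first nonzero power,
  so the powers are linearly independent. No nonzero polynomial of degree below n annihilates
  \<open>A\<close>, and by Cayley-Hamilton the characteristic polynomial is minimal.\<close>

lemma cyclic_matI:
  fixes A :: "'a :: field mat"
  assumes A: "A \<in> carrier_mat n n"
    and ij: "\<And>k. k < n \<Longrightarrow> \<exists>i<n. \<exists>j<n. (A ^\<^sub>m k) $$ (i, j) \<noteq> 0 \<and> (\<forall>l<k. (A ^\<^sub>m l) $$ (i, j) = 0)"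
  shows "cyclic_mat A"
proof -
  have "n \<le> degree r" if r: "r \<noteq> 0" "mat_poly_eval r A = 0\<^sub>m n n" for r
  proof (rule ccontr)
    assume "\<not> n \<le> degree r"
    then obtain i j where i: "i < n" "j < n" "(A ^\<^sub>m degree r) $$ (i, j) \<noteq> 0"
      "\<And>l. l < degree r \<Longrightarrow> (A ^\<^sub>m l) $$ (i, j) = 0"
      using ij[of "degree r"] by auto
    have "0 = (\<Sum>k\<le>degree r. coeff r k * (A ^\<^sub>m k) $$ (i, j))"
      using mat_poly_eval_zero_iff[of r "degree r" A] r A i by auto
    also have "\<dots> = lead_coeff r * (A ^\<^sub>m degree r) $$ (i, j)"
      using i by (subst sum.remove[of _ "degree r"]) (auto intro!: sum.neutral)
    finally show False using r i by simp
  qed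
  then have "is_min_poly A (char_poly A)"
    using degree_monic_char_poly[OF A] cayley_hamilton[OF A] A by (simp add: is_min_poly_def)
  then show ?thesis unfolding cyclic_mat_def min_poly_def using is_min_poly_unique by blast
qed

section \<open>Tame matrices are invertible and semisimple\<close>

text \<open>Over a finite field a matrix is invertible and semisimple iff its multiplicative order is
  prime to the characteristic; this description is visibly stable under similarity and direct sums.\<close>

definition tame_mat :: "'a :: field mat \<Rightarrow> bool" where
  "tame_mat B \<longleftrightarrow> (\<exists>N. of_nat N \<noteq> (0 :: 'a) \<and> B ^\<^sub>m N = 1\<^sub>m (dim_row B))"

lemma tame_mat_invertible:
  assumes B: "B \<in> carrier_mat n n" and "tame_mat B"
  shows "invertible_mat B"
proof -
  obtain N where N: "of_nat N \<noteq> (0 :: 'a)" "B ^\<^sub>m N = 1\<^sub>m n" using assms by (auto simp: tame_mat_def)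
  then obtain M where "N = Suc M" by (cases N) auto
  then have "B ^\<^sub>m M * B = 1\<^sub>m n" "B * B ^\<^sub>m M = 1\<^sub>m n" using N pow_mat_Suc_left[OF B, of M] by auto
  then show ?thesis using B unfolding invertible_mat_def inverts_mat_def by auto
qed

text \<open>The minimal polynomial divides X^N - 1, which is separable because its derivative is N
  X^(N-1) with N nonzero in the field.\<close>

lemma tame_mat_semisimple:
  fixes B :: "'a :: {field, finite} mat"
  assumes B: "B \<in> carrier_mat n n" and "tame_mat B"
  shows "semisimple_mat B"
proof -
  obtain N where N: "of_nat N \<noteq> (0 :: 'a)" "B ^\<^sub>m N = 1\<^sub>m n" using assms by (auto simp: tame_mat_def)
  define f :: "'a poly" where "f = monom 1 N - 1"
  have N0: "N > 0" using N by (cases N) auto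
  have df: "degree f \<le> N" unfolding f_def by (intro degree_diff_le) (auto simp: degree_monom_eq)
  have "mat_poly_eval f B = 0\<^sub>m n n"
    using mat_poly_eval_zero_iff[OF df, of B] N B
    by (simp add: f_def left_diff_distrib sum_subtractf if_distrib[of "\<lambda>x. x * _"] cong: if_cong)
  then have dvd: "min_poly B dvd f" by (rule min_poly_dvd[OF B])
  have "pderiv f = monom 1 (N - 1) * [:of_nat N, 0:]"
    by (simp add: f_def pderiv_diff pderiv_monom smult_monom)
  then have "separable f"
    by (rule separable_of_pderiv_monom_mult_linear[rotated])
      (use N N0 in \<open>auto simp: f_def poly_monom power_0_left\<close>)
  then have sep: "separable (min_poly B)" using dvd by (rule separable_dvd)
  have "monic (min_poly B)" using is_min_poly_min_poly[OF B] by (simp add: is_min_poly_def)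
  then obtain P where P: "finite P" "min_poly B = \<Prod>P" "P \<subseteq> {q. irreducible q \<and> monic q}"
    using monic_square_free_irreducible_factorization separable_imp_square_free_field[OF sep] by blast
  have "separable q" if "q \<in> P" for q
    using separable_dvd[OF sep, of q] dvd_prodI[OF P(1) that, of "\<lambda>q. q"] P(2) by simp
  with P show ?thesis unfolding semisimple_mat_def by blast
qed


section \<open>Sums of two invertible cyclic matrices\<close>

text \<open>In the Laplace expansion along the last row only the corner term involves
  \<open>x\<close>, and its cofactor is the leading minor.\<close>

lemma det_corner_affine:
  fixes F :: "nat \<Rightarrow> nat \<Rightarrow> 'a :: comm_ring_1"
  shows "\<exists>c. \<forall>x. det (mat (Suc m) (Suc m) (\<lambda>(i, j). if i = m \<and> j = m then x else F i j)) =
    x * det (mat m m (\<lambda>(i, j). F i j)) + c"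
proof -
  let ?M = "\<lambda>x. mat (Suc m) (Suc m) (\<lambda>(i, j). if i = m \<and> j = m then x else F i j)"
  have del: "mat_delete (?M x) m j = mat_delete (?M 0) m j" for x j
    by (rule eq_matI) (auto simp: mat_delete_def)
  have del': "mat_delete (?M 0) m m = mat m m (\<lambda>(i, j). F i j)"
    by (rule eq_matI) (auto simp: mat_delete_def)
  have "det (?M x) = x * det (mat m m (\<lambda>(i, j). F i j)) + (\<Sum>j<m. F m j * cofactor (?M 0) m j)" for x
  proof -
    have "det (?M x) = (\<Sum>j<Suc m. ?M x $$ (m, j) * cofactor (?M x) m j)"
      by (rule laplace_expansion_row) auto
    also have "\<dots> = (\<Sum>j<Suc m. ?M x $$ (m, j) * cofactor (?M 0) m j)"
      unfolding cofactor_def del[of x] ..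
    also have "\<dots> = x * det (mat m m (\<lambda>(i, j). F i j)) + (\<Sum>j<m. F m j * cofactor (?M 0) m j)"
      by (simp add: cofactor_def del' add.commute)
    finally show ?thesis .
  qed
  then show ?thesis by blast
qed

lemma det_corner_avoid:
  fixes F :: "nat \<Rightarrow> nat \<Rightarrow> 'a :: field"
  assumes "det (mat m m (\<lambda>(i, j). F i j)) \<noteq> 0"
  shows "\<exists>y. \<forall>x. x \<noteq> y \<longrightarrow>
    det (mat (Suc m) (Suc m) (\<lambda>(i, j). if i = m \<and> j = m then x else F i j)) \<noteq> 0"
proof -
  obtain c where c: "\<And>x. det (mat (Suc m) (Suc m) (\<lambda>(i, j). if i = m \<and> j = m then x else F i j)) =
    x * det (mat m m (\<lambda>(i, j). F i j)) + c"
    using det_corner_affine[of m F] by blast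
  have "x * det (mat m m (\<lambda>(i, j). F i j)) + c \<noteq> 0"
    if "x \<noteq> - c / det (mat m m (\<lambda>(i, j). F i j))" for x
  proof
    assume "x * det (mat m m (\<lambda>(i, j). F i j)) + c = 0"
    then have "x * det (mat m m (\<lambda>(i, j). F i j)) = - c" by (simp add: eq_neg_iff_add_eq_0)
    then have "x = - c / det (mat m m (\<lambda>(i, j). F i j))" using assms by (metis nonzero_mult_div_cancel_right)
    with that show False by contradiction
  qed
  then show ?thesis unfolding c by blast
qed

text \<open>Row 0 of the k-th power has entry 1 in column k and zeros to the right of it, so
  position (0, k) witnesses the hypothesis of \<open>cyclic_matI\<close>.\<close>

lemma cyclic_mat_lower_hessenberg:
  fixes A :: "'a :: field mat"
  assumes A: "A \<in> carrier_mat n n"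
    and one: "\<And>i. Suc i < n \<Longrightarrow> A $$ (i, Suc i) = 1"
    and zero: "\<And>i j. Suc i < j \<Longrightarrow> j < n \<Longrightarrow> A $$ (i, j) = 0"
  shows "cyclic_mat A"
proof (rule cyclic_matI[OF A])
  have pow: "(A ^\<^sub>m k) $$ (0, j) = (if j = k then 1 else 0)" if "k \<le> j" "j < n" for k j
    using that
  proof (induction k arbitrary: j)
    case 0
    then show ?case using A by auto
  next
    case (Suc k)
    have "(A ^\<^sub>m Suc k) $$ (0, j) = (\<Sum>l<n. (A ^\<^sub>m k) $$ (0, l) * A $$ (l, j))"
      using Suc.prems A by (subst pow_mat.simps, intro index_mult_mat_sum[where n = n and m = n]) auto
    also have "\<dots> = (\<Sum>l<n. if l = k then A $$ (k, j) else 0)"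
    proof (intro sum.cong refl)
      fix l assume "l \<in> {..<n}"
      then show "(A ^\<^sub>m k) $$ (0, l) * A $$ (l, j) = (if l = k then A $$ (k, j) else 0)"
        using Suc.IH[of l] zero[of l j] Suc.prems by (cases "l < k") auto
    qed
    also have "\<dots> = (if j = Suc k then 1 else 0)"
      using Suc.prems one[of k] zero[of k j] by auto
    finally show ?case .
  qed
  fix k assume "k < n"
  with pow show "\<exists>i<n. \<exists>j<n. (A ^\<^sub>m k) $$ (i, j) \<noteq> 0 \<and> (\<forall>l<k. (A ^\<^sub>m l) $$ (i, j) = 0)"
    by (intro exI[of _ 0] exI[of _ k]) auto
qed

lemma pow_mat_transpose:
  fixes A :: "'a :: comm_semiring_1 mat"
  assumes A: "A \<in> carrier_mat n n"
  shows "A\<^sup>T ^\<^sub>m k = (A ^\<^sub>m k)\<^sup>T"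
proof (induction k)
  case (Suc k)
  have "A\<^sup>T ^\<^sub>m Suc k = A\<^sup>T * A\<^sup>T ^\<^sub>m k" using A by (intro pow_mat_Suc_left) auto
  also have "\<dots> = A\<^sup>T * (A ^\<^sub>m k)\<^sup>T" unfolding Suc ..
  also have "\<dots> = (A ^\<^sub>m k * A)\<^sup>T" by (rule transpose_mult[symmetric, of _ n n]) (use A in auto)
  finally show ?case by simp
qed (use A in simp)

text \<open>A matrix and its transpose are annihilated by the same polynomials. This carries the
  criterion for lower Hessenberg matrices over to upper ones.\<close>

lemma cyclic_mat_transpose:
  fixes A :: "'a :: field mat"
  assumes A: "A \<in> carrier_mat n n" and "cyclic_mat A\<^sup>T"
  shows "cyclic_mat A"
proof -
  have "mat_poly_eval p A\<^sup>T = (mat_poly_eval p A)\<^sup>T" for p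
    by (rule eq_matI) (use A in \<open>auto simp: mat_poly_eval_def pow_mat_transpose[OF A]\<close>)
  then have "mat_poly_eval p A\<^sup>T = 0\<^sub>m n n \<longleftrightarrow> mat_poly_eval p A = 0\<^sub>m n n" for p
    by (metis transpose_transpose zero_transpose_mat)
  then have "is_min_poly A\<^sup>T p \<longleftrightarrow> is_min_poly A p" for p
    using A by (simp add: is_min_poly_def)
  then show ?thesis using assms by (simp add: cyclic_mat_def min_poly_def)
qed

lemma det_nonzero_imp_invertible:
  fixes A :: "'a :: field mat"
  assumes A: "A \<in> carrier_mat n n" and "det A \<noteq> 0"
  shows "invertible_mat A"
proof -
  obtain B where "B \<in> carrier_mat n n" "A * B = 1\<^sub>m n" "B * A = 1\<^sub>m n"
    using det_non_zero_imp_unit[OF assms, of "()"] by (auto simp: Units_def ring_mat_def)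
  then show ?thesis using A unfolding invertible_mat_def inverts_mat_def by auto
qed

lemma sum_of_two_invertible_cyclic:
  fixes A :: "'a :: {field, finite} mat"
  assumes q: "CARD('a) \<ge> 3" and A: "A \<in> carrier_mat n n"
  shows "\<exists>B C. B \<in> carrier_mat n n \<and> C \<in> carrier_mat n n \<and>
    invertible_mat B \<and> cyclic_mat B \<and> invertible_mat C \<and> cyclic_mat C \<and> A = B + C"
proof -
  \<comment> \<open>The superdiagonal is lowered by 1 so that the difference \<open>L\<close> has
    ones there, and higher up \<open>U\<close> absorbs all of \<open>A\<close> so that
    \<open>L\<close> vanishes. Only the diagonal \<open>d\<close> is still free.\<close>
  define U where "U d i j = (if i = j then d i else if i = Suc j then 1 else if i > j then 0
    else if j = Suc i then A $$ (i, j) - 1 else A $$ (i, j))" for d :: "nat \<Rightarrow> 'a" and i j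
  define L where "L d i j = A $$ (i, j) - U d i j" for d i j
  \<comment> \<open>The m-th leading minors depend only on the first m diagonal entries, so earlier
    choices survive each extension.\<close>
  have "\<exists>d. det (mat m m (\<lambda>(i, j). U d i j)) \<noteq> 0 \<and> det (mat m m (\<lambda>(i, j). L d i j)) \<noteq> 0" for m
  proof (induction m)
    case 0
    show ?case by simp
  next
    case (Suc m)
    then obtain d where d: "det (mat m m (\<lambda>(i, j). U d i j)) \<noteq> 0" "det (mat m m (\<lambda>(i, j). L d i j)) \<noteq> 0"
      by blast
    obtain y where y: "\<And>x. x \<noteq> y \<Longrightarrow>
      det (mat (Suc m) (Suc m) (\<lambda>(i, j). if i = m \<and> j = m then x else U d i j)) \<noteq> 0"
      using det_corner_avoid[OF d(1)] by blast
    obtain z where z: "\<And>x. x \<noteq> z \<Longrightarrow>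
      det (mat (Suc m) (Suc m) (\<lambda>(i, j). if i = m \<and> j = m then x else L d i j)) \<noteq> 0"
      using det_corner_avoid[OF d(2)] by blast
    \<comment> \<open>The new corner of \<open>L\<close> is the entry of \<open>A\<close> minus
      \<open>x\<close>, so the value \<open>z\<close> forbidden for \<open>L\<close> becomes this
      second forbidden value of \<open>x\<close>.\<close>
    obtain x where x: "x \<noteq> y" "x \<noteq> A $$ (m, m) - z" using exists_not_in_two[OF q] by blast
    have e1: "mat (Suc m) (Suc m) (\<lambda>(i, j). U (d(m := x)) i j) =
      mat (Suc m) (Suc m) (\<lambda>(i, j). if i = m \<and> j = m then x else U d i j)"
      by (rule eq_matI) (auto simp: U_def)
    have e2: "mat (Suc m) (Suc m) (\<lambda>(i, j). L (d(m := x)) i j) =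
      mat (Suc m) (Suc m) (\<lambda>(i, j). if i = m \<and> j = m then A $$ (m, m) - x else L d i j)"
      by (rule eq_matI) (auto simp: L_def U_def)
    have "A $$ (m, m) - x \<noteq> z" using x(2) by auto
    from y[OF x(1), folded e1] z[OF this, folded e2] show ?case by blast
  qed
  then obtain d where d: "det (mat n n (\<lambda>(i, j). U d i j)) \<noteq> 0" "det (mat n n (\<lambda>(i, j). L d i j)) \<noteq> 0"
    by blast
  define B where "B = mat n n (\<lambda>(i, j). U d i j)"
  define C where "C = mat n n (\<lambda>(i, j). L d i j)"
  have BC: "B \<in> carrier_mat n n" "C \<in> carrier_mat n n" by (auto simp: B_def C_def)
  have "cyclic_mat B"
    by (rule cyclic_mat_transpose[OF BC(1)], rule cyclic_mat_lower_hessenberg[where n = n])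
      (auto simp: B_def U_def)
  moreover have "cyclic_mat C"
    by (rule cyclic_mat_lower_hessenberg[OF BC(2)]) (auto simp: C_def L_def U_def)
  moreover have "A = B + C" by (rule eq_matI) (use A in \<open>auto simp: B_def C_def L_def\<close>)
  moreover have "invertible_mat B" "invertible_mat C"
    using d[folded B_def C_def] BC by (auto intro: det_nonzero_imp_invertible)
  ultimately show ?thesis using BC by blast
qed


section \<open>Tame Hessenberg matrices with prescribed characteristic polynomial\<close>

lemma degree_indexed_family_independent:
  fixes w :: "nat \<Rightarrow> 'a :: field poly"
  assumes "\<And>i. i < n \<Longrightarrow> degree (w i) = i \<and> w i \<noteq> 0"
    and "(\<Sum>i<n. Polynomial.smult (c i) (w i)) = 0" and "i < n"
  shows "c i = 0"
  using assms
proof (induction n arbitrary: i)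
  case (Suc n)
  have "coeff (\<Sum>i<n. Polynomial.smult (c i) (w i)) n = 0"
    using Suc.prems(1) by (auto simp: coeff_sum coeff_eq_0 intro!: sum.neutral)
  then have "c n * coeff (w n) n = 0" using arg_cong[OF Suc.prems(2), of "\<lambda>p. coeff p n"] by simp
  then have "c n = 0" using Suc.prems(1)[of n] by (metis leading_coeff_0_iff lessI mult_eq_0_iff)
  then show ?case using Suc.IH[of i] Suc.prems by (cases "i = n") auto
qed simp

text \<open>The hypothesis on \<open>w\<close> says that \<open>H\<close> is the matrix of multiplication by \<open>X\<close> on \<open>K[X]/(f)\<close> with
  respect to the basis \<open>w\<close>.\<close>

lemma tame_mat_of_mult_X:
  fixes H :: "'a :: {field, finite} mat" and w :: "nat \<Rightarrow> 'a poly"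
  assumes H: "H \<in> carrier_mat n n"
    and w: "\<And>j. j < n \<Longrightarrow> degree (w j) = j \<and> w j \<noteq> 0"
    and f: "monic f" "degree f = n" "separable f" "poly f 0 \<noteq> 0" and n: "n > 0"
    and mult: "\<And>j. j < n \<Longrightarrow> f dvd [:0, 1:] * w j - (\<Sum>i<n. Polynomial.smult (H $$ (i, j)) (w i))"
  shows "tame_mat H"
proof -
  obtain N where N: "of_nat N \<noteq> (0 :: 'a)" "f dvd monom 1 N - 1"
    using separable_dvd_X_power_minus_one[OF f(1,3,4)] f n by auto
  \<comment> \<open>Powers of \<open>H\<close> represent multiplication by powers of X in the same
    basis modulo \<open>f\<close>.\<close>
  have pow: "f dvd monom 1 k * w j - (\<Sum>i<n. Polynomial.smult ((H ^\<^sub>m k) $$ (i, j)) (w i))"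
    if j: "j < n" for k j
    using j
  proof (induction k arbitrary: j)
    case 0
    have "(\<Sum>i<n. Polynomial.smult ((H ^\<^sub>m 0) $$ (i, j)) (w i)) = (\<Sum>i<n. if i = j then w i else 0)"
      using H 0 by (intro sum.cong) auto
    then show ?case using 0 by simp
  next
    case (Suc k)
    have "(\<Sum>i<n. Polynomial.smult ((H ^\<^sub>m Suc k) $$ (i, j)) (w i)) =
      (\<Sum>i<n. \<Sum>l<n. Polynomial.smult (H $$ (l, j)) (Polynomial.smult ((H ^\<^sub>m k) $$ (i, l)) (w i)))"
    proof (intro sum.cong refl)
      fix i assume i: "i \<in> {..<n}"
      have "(H ^\<^sub>m Suc k) $$ (i, j) = (\<Sum>l<n. (H ^\<^sub>m k) $$ (i, l) * H $$ (l, j))"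
        using Suc.prems H i by (subst pow_mat.simps, intro index_mult_mat_sum[where n = n and m = n]) auto
      then show "Polynomial.smult ((H ^\<^sub>m Suc k) $$ (i, j)) (w i) =
        (\<Sum>l<n. Polynomial.smult (H $$ (l, j)) (Polynomial.smult ((H ^\<^sub>m k) $$ (i, l)) (w i)))"
        by (simp add: smult_sum mult.commute)
    qed
    also have "\<dots> = (\<Sum>l<n. Polynomial.smult (H $$ (l, j)) (\<Sum>i<n. Polynomial.smult ((H ^\<^sub>m k) $$ (i, l)) (w i)))"
      by (subst sum.swap) (simp add: smult_sum2)
    finally have "monom 1 (Suc k) * w j - (\<Sum>i<n. Polynomial.smult ((H ^\<^sub>m Suc k) $$ (i, j)) (w i)) =
      monom 1 k * ([:0, 1:] * w j - (\<Sum>l<n. Polynomial.smult (H $$ (l, j)) (w l))) +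
      (\<Sum>l<n. Polynomial.smult (H $$ (l, j)) (monom 1 k * w l - (\<Sum>i<n. Polynomial.smult ((H ^\<^sub>m k) $$ (i, l)) (w i))))"
      by (simp add: monom_Suc sum_subtractf smult_diff_right right_diff_distrib sum_distrib_left)
    also have "f dvd \<dots>"
      by (intro dvd_add dvd_mult mult dvd_sum dvd_smult Suc.IH) (use Suc.prems in auto)
    finally show ?case .
  qed
  have "(H ^\<^sub>m N) $$ (i, j) = (if i = j then 1 else 0)" if ij: "i < n" "j < n" for i j
  proof -
    \<comment> \<open>Since X^N is 1 modulo \<open>f\<close>, this difference is a multiple of
      \<open>f\<close> of degree below n. It is therefore 0, and independence of the
      \<open>w i\<close> yields the entries of the power.\<close>
    define r where "r = (\<Sum>i<n. Polynomial.smult ((if i = j then 1 else 0) - (H ^\<^sub>m N) $$ (i, j)) (w i))"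
    have "(\<Sum>i<n. Polynomial.smult (if i = j then 1 else 0) (w i)) = (\<Sum>i<n. if i = j then w i else 0)"
      by (intro sum.cong) auto
    also have "\<dots> = w j" using ij by simp
    finally have "r = w j - (\<Sum>i<n. Polynomial.smult ((H ^\<^sub>m N) $$ (i, j)) (w i))"
      by (simp add: r_def smult_diff_left sum_subtractf)
    also have "\<dots> = (monom 1 N * w j - (\<Sum>i<n. Polynomial.smult ((H ^\<^sub>m N) $$ (i, j)) (w i))) - (monom 1 N - 1) * w j"
      by (simp add: algebra_simps)
    also have "f dvd \<dots>" by (rule dvd_diff[OF pow[OF ij(2)] dvd_mult2[OF N(2)]])
    finally have "f dvd r" .
    moreover have "r = 0 \<or> degree r < n"
      unfolding r_def using n w by (intro disjI2 degree_sum_less) (auto intro: le_less_trans[OF degree_smult_le])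
    ultimately have "r = 0" using f(2) dvd_imp_degree_le[of f r] by fastforce
    then show ?thesis
      using degree_indexed_family_independent[OF w, of n "\<lambda>i. (if i = j then 1 else 0) - (H ^\<^sub>m N) $$ (i, j)" i] ij
      by (simp add: r_def)
  qed
  then have "H ^\<^sub>m N = 1\<^sub>m n" by (intro eq_matI) (use H in auto)
  with N H show ?thesis by (auto simp: tame_mat_def)
qed

text \<open>For \<open>b \<noteq> 0\<close> this is an upper Hessenberg matrix of size \<open>m + 2\<close> with subdiagonal \<open>b\<close>, an arbitrary
  column \<open>u\<close> added above the subdiagonal entry in the last but one column, and the last column chosen
  so that the characteristic polynomial has the coefficients \<open>c\<close>.\<close>

definition hess_last :: "nat \<Rightarrow> 'a :: field \<Rightarrow> (nat \<Rightarrow> 'a) \<Rightarrow> (nat \<Rightarrow> 'a) \<Rightarrow> nat \<Rightarrow> 'a" where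
  "hess_last m b u c i = (if i = Suc m then - c (Suc m) - u m
     else (- c (Suc m) - u m) * u i / b - (if i = 0 then 0 else u (i - 1)) - c i / b ^ (Suc m - i))"

definition hess_mat :: "nat \<Rightarrow> 'a :: field \<Rightarrow> (nat \<Rightarrow> 'a) \<Rightarrow> (nat \<Rightarrow> 'a) \<Rightarrow> 'a mat" where
  "hess_mat m b u c = mat (Suc (Suc m)) (Suc (Suc m)) (\<lambda>(i, j).
     if j = Suc m then hess_last m b u c i
     else (if i = Suc j then b else 0) + (if j = m \<and> i \<le> m then u i else 0))"

lemma hess_mat_carrier [simp]: "hess_mat m b u c \<in> carrier_mat (Suc (Suc m)) (Suc (Suc m))"
  by (simp add: hess_mat_def)

text \<open>The matrix is multiplication by X on K[X]/(f) in a suitable basis, so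
  \<open>tame_mat_of_mult_X\<close> applies.\<close>

lemma tame_hess_mat:
  fixes f :: "'a :: {field, finite} poly"
  assumes b: "b \<noteq> 0" and f: "monic f" "degree f = Suc (Suc m)" "separable f" "poly f 0 \<noteq> 0"
  shows "tame_mat (hess_mat m b u (coeff f))"
proof -
  let ?n = "Suc (Suc m)" and ?H = "hess_mat m b u (coeff f)"
  define v where "v i = monom (1 / b ^ i) i" for i
  define U where "U = (\<Sum>i\<le>m. Polynomial.smult (u i) (v i))"
  \<comment> \<open>The scaled powers (X/b)^i put \<open>b\<close> on the subdiagonal. Only the last
    basis vector is modified, so that X times \<open>w m\<close> equals
    \<open>U + b * w (Suc m)\<close>, which is the column containing \<open>u\<close>.\<close>
  define w where "w i = (if i \<le> m then v i else v (Suc m) - Polynomial.smult (1 / b) U)" for i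
  have cs: "coeff (\<Sum>i\<le>m. Polynomial.smult (c i) (v i)) k = (if k \<le> m then c k / b ^ k else 0)" for c k
    by (auto simp: coeff_sum v_def if_distrib[of "\<lambda>x. _ * x"] cong: if_cong)
  have cw: "coeff (w (Suc m)) k = (if k = Suc m then 1 / b ^ Suc m else if k \<le> m then - u k / b ^ Suc k else 0)" for k
    unfolding w_def U_def by (simp add: cs) (simp add: v_def)
  have split: "(\<Sum>i<?n. g i) = (\<Sum>i\<le>m. g i) + g (Suc m)" for g :: "nat \<Rightarrow> 'a poly"
    by (simp add: lessThan_Suc_atMost)
  have wm: "(\<Sum>i\<le>m. Polynomial.smult (c i) (w i)) = (\<Sum>i\<le>m. Polynomial.smult (c i) (v i))" for c
    by (intro sum.cong) (auto simp: w_def)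
  have xv: "[:0, 1:] * v j = Polynomial.smult b (v (Suc j))" for j
    using b by (simp add: v_def smult_monom monom_Suc)
  show ?thesis
  proof (rule tame_mat_of_mult_X[OF hess_mat_carrier _ f])
    fix j assume j: "j < ?n"
    show "degree (w j) = j \<and> w j \<noteq> 0"
    proof (cases "j \<le> m")
      case True
      then show ?thesis using b by (simp add: w_def v_def degree_monom_eq)
    next
      case False
      then have [simp]: "j = Suc m" using j by simp
      have "coeff (w (Suc m)) (Suc m) \<noteq> 0" using b by (simp add: cw)
      moreover have "degree (w (Suc m)) \<le> Suc m" by (rule degree_le) (simp add: cw)
      ultimately show ?thesis by (metis \<open>j = Suc m\<close> le_degree antisym coeff_0)
    qed
    \<comment> \<open>The relation is exact in all columns but the last, where the defect is a
      scalar multiple of \<open>f\<close>.\<close>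
    have "[:0, 1:] * w j - (\<Sum>i<?n. Polynomial.smult (?H $$ (i, j)) (w i)) = 
      (if j = Suc m then Polynomial.smult (1 / b ^ Suc m) f else 0)"
    proof -
      consider "j < m" | "j = m" | "j = Suc m" using j by linarith
      then show ?thesis
      proof cases
        case 1
        then have "(\<Sum>i<?n. Polynomial.smult (?H $$ (i, j)) (w i)) = (\<Sum>i<?n. if i = Suc j then Polynomial.smult b (w i) else 0)"
          by (intro sum.cong) (auto simp: hess_mat_def)
        also have "\<dots> = Polynomial.smult b (v (Suc j))" using 1 by (simp add: w_def)
        finally show ?thesis using 1 xv[of j] by (simp add: w_def)
      next
        case 2
        then have "(\<Sum>i<?n. Polynomial.smult (?H $$ (i, j)) (w i)) = U + Polynomial.smult b (w (Suc m))"
          unfolding split U_def wm[symmetric] by (simp add: hess_mat_def)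
        also have "\<dots> = Polynomial.smult b (v (Suc m))"
          using b by (simp add: w_def smult_diff_right)
        finally show ?thesis using 2 xv[of j] by (simp add: w_def)
      next
        case 3
        let ?z = "hess_last m b u (coeff f)"
        have "(\<Sum>i<?n. Polynomial.smult (?H $$ (i, j)) (w i)) = (\<Sum>i\<le>m. Polynomial.smult (?z i) (v i)) + Polynomial.smult (?z (Suc m)) (w (Suc m))"
          unfolding split wm[symmetric] using 3 by (simp add: hess_mat_def)
        moreover have "[:0, 1:] * w (Suc m) - ((\<Sum>i\<le>m. Polynomial.smult (?z i) (v i)) + Polynomial.smult (?z (Suc m)) (w (Suc m))) =
          Polynomial.smult (1 / b ^ Suc m) f"
        proof (rule poly_eqI)
          fix k
          consider "k \<le> m" | "k = Suc m" | "k = ?n" | "k > ?n" by linarith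
          then show "coeff ([:0, 1:] * w (Suc m) - ((\<Sum>i\<le>m. Polynomial.smult (?z i) (v i)) + Polynomial.smult (?z (Suc m)) (w (Suc m)))) k =
            coeff (Polynomial.smult (1 / b ^ Suc m) f) k"
          proof cases
            case 1
            \<comment> \<open>Reconciles the factor 1/b^(m+1) of \<open>f\<close> with the factor
              1/b^k of the basis vector; this is the origin of the power of \<open>b\<close> in
              \<open>hess_last\<close>.\<close>
            then have "b ^ Suc m = b ^ (Suc m - k) * b ^ k" by (simp add: power_add[symmetric])
            then show ?thesis using 1 b
              by (cases k) (auto simp: cs cw hess_last_def field_simps)
          next
            case 2
            then show ?thesis
              by (simp add: cs cw hess_last_def diff_divide_distrib)
          next
            case 3
            then show ?thesis using f by (simp add: cs cw)
          next
            case 4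
            then show ?thesis using f by (cases k) (auto simp: cs cw coeff_eq_0)
          qed
        qed
        ultimately show ?thesis using 3 by simp
      qed
    qed
    then show "f dvd [:0, 1:] * w j - (\<Sum>i<?n. Polynomial.smult (?H $$ (i, j)) (w i))"
      by (simp add: dvd_smult)
  qed simp
qed

text \<open>Outside the last column the sum is right because the subdiagonals add up to 1 and only
  one summand carries \<open>u\<close>. In the last column the shifted terms
  \<open>u (i - 1)\<close> cancel, and the hypotheses are the remaining equations, row by
  row.\<close>

lemma hess_mat_add:
  fixes u a f g :: "nat \<Rightarrow> 'a :: field"
  assumes "be + ga = 1" "be \<noteq> 0" "ga \<noteq> 0" "a (Suc m) = f (Suc m) + g (Suc m)"
    and "\<And>i. i \<le> m \<Longrightarrow> ((- a (Suc m) - u m) - (- g (Suc m) - u m) / ga) * u i =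
      a i - f i / be ^ (Suc m - i) - g i / ga ^ (Suc m - i)"
  shows "hess_mat m 1 u a = hess_mat m be (\<lambda>_. 0) f + hess_mat m ga u g"
proof (rule eq_matI)
  fix i j assume "i < dim_row (hess_mat m be (\<lambda>_. 0) f + hess_mat m ga u g)"
    "j < dim_col (hess_mat m be (\<lambda>_. 0) f + hess_mat m ga u g)"
  then have ij: "i < Suc (Suc m)" "j < Suc (Suc m)" by (auto simp: hess_mat_def)
  have "hess_last m 1 u a i = hess_last m be (\<lambda>_. 0) f i + hess_last m ga u g i"
  proof (cases "i = Suc m")
    case False
    then have i: "i \<le> m" using ij by simp
    have "hess_last m 1 u a i - hess_last m be (\<lambda>_. 0) f i - hess_last m ga u g i =
      ((- a (Suc m) - u m) - (- g (Suc m) - u m) / ga) * u i -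
      (a i - f i / be ^ (Suc m - i) - g i / ga ^ (Suc m - i))"
      using False by (simp add: hess_last_def left_diff_distrib)
    then show ?thesis using assms(5)[OF i] by (simp add: algebra_simps)
  qed (simp add: hess_last_def assms)
  then show "hess_mat m 1 u a $$ (i, j) = (hess_mat m be (\<lambda>_. 0) f + hess_mat m ga u g) $$ (i, j)"
    using ij assms(1) by (auto simp: hess_mat_def)
qed (auto simp: hess_mat_def)


section \<open>Direct sums, similarity and transposition\<close>

lemma pow_mat_add_exponent:
  assumes "A \<in> carrier_mat n n"
  shows "A ^\<^sub>m (k + l) = A ^\<^sub>m k * A ^\<^sub>m l"
proof (induction l)
  case (Suc l)
  then show ?case using assms by (simp add: assoc_mult_mat[of _ n n _ n _ n])
qed (use assms in simp)

lemma pow_mat_multiple_eq_one: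
  assumes A: "A \<in> carrier_mat n n" and "A ^\<^sub>m k = 1\<^sub>m n"
  shows "A ^\<^sub>m (k * l) = 1\<^sub>m n"
proof (induction l)
  case (Suc l)
  have "A ^\<^sub>m (k * Suc l) = A ^\<^sub>m k * A ^\<^sub>m (k * l)" using pow_mat_add_exponent[OF A] by simp
  then show ?case using Suc assms by simp
qed (use assms in simp)

lemma pow_mat_intertwine:
  assumes X: "X \<in> carrier_mat n n" and B: "B \<in> carrier_mat d d" and P: "P \<in> carrier_mat n d"
    and XP: "X * P = P * B"
  shows "X ^\<^sub>m k * P = P * B ^\<^sub>m k"
proof (induction k)
  case (Suc k)
  have "X ^\<^sub>m Suc k * P = X ^\<^sub>m k * (X * P)" using X P by (simp add: assoc_mult_mat[of _ n n _ n _ d])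
  also have "\<dots> = (X ^\<^sub>m k * P) * B" unfolding XP using X P B by (simp add: assoc_mult_mat[of _ n n _ d _ d])
  also have "\<dots> = P * B ^\<^sub>m Suc k" unfolding Suc using P B by (simp add: assoc_mult_mat[of _ n d _ d _ d])
  finally show ?case .
qed (use X P B in simp)

text \<open>K^n is the direct sum of the column spans of \<open>P\<close> and \<open>N\<close>, with
  coordinate maps \<open>Q\<close> and \<open>R\<close>. Rectangular factors take the place of
  explicit block matrices.\<close>

locale direct_sum_mat =
  fixes n d e :: nat and P N Q R :: "'a :: field mat"
  assumes P: "P \<in> carrier_mat n d" and N: "N \<in> carrier_mat n e"
    and Q: "Q \<in> carrier_mat d n" and R: "R \<in> carrier_mat e n"
    and QP: "Q * P = 1\<^sub>m d" and RN: "R * N = 1\<^sub>m e"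
    and QN: "Q * N = 0\<^sub>m d e" and RP: "R * P = 0\<^sub>m e d"
    and PQ_NR: "P * Q + N * R = 1\<^sub>m n"
begin

lemma mult_left:
  assumes X: "X \<in> carrier_mat n n"
  shows "X = X * P * Q + X * N * R"
proof -
  have "X = X * (P * Q + N * R)" using X PQ_NR by simp
  also have "\<dots> = X * (P * Q) + X * (N * R)"
    using X P N Q R by (intro mult_add_distrib_mat) auto
  finally show ?thesis
    using X P N Q R by (simp add: assoc_mult_mat[of _ n n _ d _ n] assoc_mult_mat[of _ n n _ e _ n])
qed

text \<open>The block diagonal matrix with blocks \<open>B1\<close>, \<open>B2\<close>, written in
  the basis formed by the columns of \<open>P\<close> and \<open>N\<close>.\<close>

definition "glue B1 B2 = P * B1 * Q + N * B2 * R"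

context
  fixes B1 B2 :: "'a mat" assumes B1: "B1 \<in> carrier_mat d d" and B2: "B2 \<in> carrier_mat e e"
begin

lemma glue_carrier: "glue B1 B2 \<in> carrier_mat n n"
  unfolding glue_def using P N Q R B1 B2 by auto

lemma glue_P: "glue B1 B2 * P = P * B1"
proof -
  have "glue B1 B2 * P = P * B1 * Q * P + N * B2 * R * P"
    unfolding glue_def using P N Q R B1 B2 by (intro add_mult_distrib_mat) auto
  also have "P * B1 * Q * P = P * B1 * (Q * P)"
    using P Q B1 by (intro assoc_mult_mat) auto
  also have "N * B2 * R * P = N * B2 * (R * P)"
    using P N R B2 by (intro assoc_mult_mat) auto
  finally show ?thesis using P N B1 B2 by (simp add: QP RP)
qed

lemma glue_N: "glue B1 B2 * N = N * B2"
proof -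
  have "glue B1 B2 * N = P * B1 * Q * N + N * B2 * R * N"
    unfolding glue_def using P N Q R B1 B2 by (intro add_mult_distrib_mat) auto
  also have "P * B1 * Q * N = P * B1 * (Q * N)"
    using P N Q B1 by (intro assoc_mult_mat) auto
  also have "N * B2 * R * N = N * B2 * (R * N)"
    using N R B2 by (intro assoc_mult_mat) auto
  finally show ?thesis using P N B1 B2 by (simp add: QN RN)
qed

text \<open>The product of the two exponents works for both blocks and is still nonzero in the
  field. The resulting power fixes \<open>P\<close> and \<open>N\<close>, hence everything.\<close>

lemma tame_glue:
  assumes "tame_mat B1" "tame_mat B2"
  shows "tame_mat (glue B1 B2)"
proof -
  obtain k where k: "of_nat k \<noteq> (0 :: 'a)" "B1 ^\<^sub>m k = 1\<^sub>m d" using assms B1 by (auto simp: tame_mat_def)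
  obtain l where l: "of_nat l \<noteq> (0 :: 'a)" "B2 ^\<^sub>m l = 1\<^sub>m e" using assms B2 by (auto simp: tame_mat_def)
  have "glue B1 B2 ^\<^sub>m (k * l) * P = P"
    using pow_mat_intertwine[OF glue_carrier B1 P glue_P] pow_mat_multiple_eq_one[OF B1 k(2)] P by simp
  moreover have "glue B1 B2 ^\<^sub>m (k * l) * N = N"
    using pow_mat_intertwine[OF glue_carrier B2 N glue_N] pow_mat_multiple_eq_one[OF B2 l(2), of k] N
    by (simp add: mult.commute)
  ultimately have "glue B1 B2 ^\<^sub>m (k * l) = 1\<^sub>m n"
    using mult_left[of "glue B1 B2 ^\<^sub>m (k * l)"] glue_carrier PQ_NR by simp
  moreover have "of_nat (k * l) \<noteq> (0 :: 'a)" using k l by simp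
  ultimately show ?thesis using glue_carrier unfolding tame_mat_def by (metis carrier_matD(1))
qed

end

end

definition two_tame :: "nat \<Rightarrow> 'a :: field mat \<Rightarrow> bool" where
  "two_tame n A \<longleftrightarrow> (\<exists>B C. B \<in> carrier_mat n n \<and> C \<in> carrier_mat n n \<and> tame_mat B \<and> tame_mat C \<and> A = B + C)"

lemma (in direct_sum_mat) two_tame_glue:
  assumes "two_tame d M1" "two_tame e M2"
  shows "two_tame n (P * M1 * Q + N * M2 * R)"
proof -
  obtain B1 C1 where 1: "B1 \<in> carrier_mat d d" "C1 \<in> carrier_mat d d" "tame_mat B1" "tame_mat C1" "M1 = B1 + C1"
    using assms by (auto simp: two_tame_def)
  obtain B2 C2 where 2: "B2 \<in> carrier_mat e e" "C2 \<in> carrier_mat e e" "tame_mat B2" "tame_mat C2" "M2 = B2 + C2"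
    using assms by (auto simp: two_tame_def)
  have "P * (B1 + C1) * Q = P * B1 * Q + P * C1 * Q"
    using P Q 1 by (simp add: mult_add_distrib_mat[of _ n d _ d] add_mult_distrib_mat[of _ n d _ _ n])
  moreover have "N * (B2 + C2) * R = N * B2 * R + N * C2 * R"
    using N R 2 by (simp add: mult_add_distrib_mat[of _ n e _ e] add_mult_distrib_mat[of _ n e _ _ n])
  moreover have "P * B1 * Q \<in> carrier_mat n n" "P * C1 * Q \<in> carrier_mat n n"
    "N * B2 * R \<in> carrier_mat n n" "N * C2 * R \<in> carrier_mat n n"
    using P Q N R 1 2 by auto
  moreover have "(X + Y) + (Z + W) = (X + Z) + (Y + W)"
    if "X \<in> carrier_mat n n" "Y \<in> carrier_mat n n" "Z \<in> carrier_mat n n" "W \<in> carrier_mat n n" for X Y Z W :: "'a mat"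
    by (rule eq_matI) (use that in auto)
  ultimately have "P * M1 * Q + N * M2 * R = glue B1 B2 + glue C1 C2"
    using 1(5) 2(5) by (simp add: glue_def)
  then show ?thesis unfolding two_tame_def
    using tame_glue[OF 1(1) 2(1) 1(3) 2(3)] tame_glue[OF 1(2) 2(2) 1(4) 2(4)]
      glue_carrier[OF 1(1) 2(1)] glue_carrier[OF 1(2) 2(2)] by blast
qed

lemma two_tame_zero_dim: "two_tame 0 (0\<^sub>m 0 0 :: 'a :: field mat)"
  unfolding two_tame_def tame_mat_def
  by (intro exI[of _ "0\<^sub>m 0 0"] conjI exI[of _ 1] eq_matI) auto

text \<open>Similarity is the direct sum with an empty second summand.\<close>

lemma two_tame_similar:
  fixes P Q M :: "'a :: field mat"
  assumes P: "P \<in> carrier_mat n n" and Q: "Q \<in> carrier_mat n n" and PQ: "P * Q = 1\<^sub>m n" "Q * P = 1\<^sub>m n"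
    and M: "M \<in> carrier_mat n n" and "two_tame n M"
  shows "two_tame n (P * M * Q)"
proof -
  interpret direct_sum_mat n n 0 P "0\<^sub>m n 0" Q "0\<^sub>m 0 n"
    by standard (use assms in auto)
  have "two_tame n (P * M * Q + 0\<^sub>m n 0 * 0\<^sub>m 0 0 * 0\<^sub>m 0 n)"
    using two_tame_glue assms(6) two_tame_zero_dim by blast
  then show ?thesis using P Q M by simp
qed

lemma tame_mat_transpose:
  assumes "B \<in> carrier_mat n n" "tame_mat B"
  shows "tame_mat B\<^sup>T"
  using assms by (auto simp: tame_mat_def pow_mat_transpose[OF assms(1)])

lemma two_tame_transpose:
  assumes "two_tame n A"
  shows "two_tame n A\<^sup>T"
proof -
  obtain B C where "B \<in> carrier_mat n n" "C \<in> carrier_mat n n" "tame_mat B" "tame_mat C" "A = B + C"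
    using assms by (auto simp: two_tame_def)
  then show ?thesis unfolding two_tame_def
    by (intro exI[of _ "B\<^sup>T"] exI[of _ "C\<^sup>T"]) (auto intro: tame_mat_transpose simp: transpose_add)
qed


section \<open>Companion matrices as sums of two tame matrices\<close>

text \<open>A unipotent change of basis that alters only the last basis vector.\<close>

definition last_col_mat :: "nat \<Rightarrow> (nat \<Rightarrow> 'a :: field) \<Rightarrow> 'a mat" where
  "last_col_mat m v = mat (Suc (Suc m)) (Suc (Suc m))
     (\<lambda>(i, j). if i = j then 1 else if j = Suc m then v i else 0)"

lemma last_col_mat_carrier [simp]: "last_col_mat m v \<in> carrier_mat (Suc (Suc m)) (Suc (Suc m))"
  by (simp add: last_col_mat_def)

lemma last_col_mat_mult_left:
  fixes X :: "'a :: field mat"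
  assumes X: "X \<in> carrier_mat (Suc (Suc m)) (Suc (Suc m))" and ij: "i < Suc (Suc m)" "j < Suc (Suc m)"
  shows "(last_col_mat m v * X) $$ (i, j) = X $$ (i, j) + (if i \<le> m then v i * X $$ (Suc m, j) else 0)"
proof -
  have "(last_col_mat m v * X) $$ (i, j) = (\<Sum>k\<le>m. last_col_mat m v $$ (i, k) * X $$ (k, j))
    + last_col_mat m v $$ (i, Suc m) * X $$ (Suc m, j)"
    by (subst index_mult_mat_sum[OF ij last_col_mat_carrier X]) (simp add: lessThan_Suc_atMost)
  also have "(\<Sum>k\<le>m. last_col_mat m v $$ (i, k) * X $$ (k, j)) = (\<Sum>k\<le>m. if k = i then X $$ (i, j) else 0)"
    using ij by (intro sum.cong) (auto simp: last_col_mat_def)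
  finally show ?thesis using ij by (cases "i = Suc m") (auto simp: last_col_mat_def)
qed

lemma last_col_mat_mult_right:
  fixes X :: "'a :: field mat"
  assumes X: "X \<in> carrier_mat (Suc (Suc m)) (Suc (Suc m))" and ij: "i < Suc (Suc m)" "j < Suc (Suc m)"
  shows "(X * last_col_mat m v) $$ (i, j) =
    X $$ (i, j) + (if j = Suc m then \<Sum>k\<le>m. X $$ (i, k) * v k else 0)"
proof -
  have "(X * last_col_mat m v) $$ (i, j) = (\<Sum>k\<le>m. X $$ (i, k) * last_col_mat m v $$ (k, j))
    + X $$ (i, Suc m) * last_col_mat m v $$ (Suc m, j)"
    by (subst index_mult_mat_sum[OF ij X last_col_mat_carrier]) (simp add: lessThan_Suc_atMost)
  also have "(\<Sum>k\<le>m. X $$ (i, k) * last_col_mat m v $$ (k, j)) =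
    (\<Sum>k\<le>m. if j = Suc m then X $$ (i, k) * v k else if k = j then X $$ (i, j) else 0)"
    using ij by (intro sum.cong) (auto simp: last_col_mat_def)
  finally show ?thesis using ij by (auto simp: last_col_mat_def)
qed

lemma last_col_mat_inverse:
  "last_col_mat m (\<lambda>i. - u i) * last_col_mat m u = 1\<^sub>m (Suc (Suc m))"
  "last_col_mat m u * last_col_mat m (\<lambda>i. - u i) = 1\<^sub>m (Suc (Suc m))"
  by (rule eq_matI; simp only: index_one_mat last_col_mat_mult_left[OF last_col_mat_carrier];
      auto simp: last_col_mat_def)+

text \<open>Subtracting the combination of the first basis vectors with coefficients
  \<open>u\<close> from the last one introduces the free column. The identity is checked in the
  inverse-free form \<open>?H0 * ?T = ?T * ?Hu\<close>.\<close>

lemma hess_mat_conjugate: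
  fixes a u :: "nat \<Rightarrow> 'a :: field"
  shows "hess_mat m 1 (\<lambda>_. 0) a = last_col_mat m (\<lambda>i. - u i) * hess_mat m 1 u a * last_col_mat m u"
proof -
  let ?n = "Suc (Suc m)" and ?T = "last_col_mat m (\<lambda>i. - u i)" and ?T' = "last_col_mat m u"
  let ?H0 = "hess_mat m 1 (\<lambda>_. 0) a" and ?Hu = "hess_mat m 1 u a"
  have eq: "?H0 * ?T = ?T * ?Hu"
  proof (rule eq_matI)
    fix i j assume "i < dim_row (?T * ?Hu)" "j < dim_col (?T * ?Hu)"
    then have ij: "i < ?n" "j < ?n" by (auto simp: hess_mat_def last_col_mat_def)
    have "(\<Sum>k\<le>m. ?H0 $$ (i, k) * - u k) = (\<Sum>k\<le>m. if k = i - 1 \<and> i \<noteq> 0 then - u k else 0)"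
      using ij by (intro sum.cong) (auto simp: hess_mat_def)
    also have "\<dots> = (if i = 0 then 0 else - u (i - 1))" using ij by auto
    finally have s: "(\<Sum>k\<le>m. ?H0 $$ (i, k) * - u k) = (if i = 0 then 0 else - u (i - 1))" .
    show "(?H0 * ?T) $$ (i, j) = (?T * ?Hu) $$ (i, j)"
      unfolding last_col_mat_mult_left[OF hess_mat_carrier ij] last_col_mat_mult_right[OF hess_mat_carrier ij] s
      using ij by (cases "i = Suc m") (auto simp: hess_mat_def hess_last_def algebra_simps)
  qed (auto simp: hess_mat_def last_col_mat_def)
  have "?H0 = ?H0 * (?T * ?T')" unfolding last_col_mat_inverse
    by (rule right_mult_one_mat[OF hess_mat_carrier, symmetric])
  also have "\<dots> = ?H0 * ?T * ?T'"
    by (rule assoc_mult_mat[symmetric, OF hess_mat_carrier last_col_mat_carrier last_col_mat_carrier])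
  finally show ?thesis unfolding eq .
qed

text \<open>Both summands get prescribed separable characteristic polynomials \<open>f\<close> and
  \<open>g\<close>. The traces are tuned so that each equation for \<open>u i\<close> in
  \<open>hess_mat_add\<close> has coefficient 1, and then \<open>u\<close> can simply be read
  off.\<close>

lemma two_tame_hess_mat_exists:
  fixes a :: "nat \<Rightarrow> 'a :: {field, finite}"
  assumes q: "CARD('a) \<ge> 3"
  shows "\<exists>u. two_tame (Suc (Suc m)) (hess_mat m 1 u a)"
proof -
  obtain be :: 'a where be: "be \<noteq> 0" "be \<noteq> 1" using exists_not_in_two[OF q] by blast
  define ga where "ga = 1 - be"
  have ga: "be + ga = 1" "ga \<noteq> 0" using be by (auto simp: ga_def)
  define ok where "ok f \<longleftrightarrow> monic f \<and> degree f = Suc (Suc m) \<and> separable f \<and> poly f 0 \<noteq> 0" for f :: "'a poly"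
  have *: "two_tame (Suc (Suc m)) (hess_mat m 1 u a)"
    if "ok f" "ok g" "hess_mat m 1 u a = hess_mat m be (\<lambda>_. 0) (coeff f) + hess_mat m ga u (coeff g)" for f g u
    unfolding two_tame_def
    by (intro exI[of _ "hess_mat m be (\<lambda>_. 0) (coeff f)"] exI[of _ "hess_mat m ga u (coeff g)"] conjI
        hess_mat_carrier tame_hess_mat that(3)) (use that be ga in \<open>auto simp: ok_def\<close>)
  show ?thesis
  proof (cases "m = 0 \<and> (2 :: 'a) = 0")
    case True
    \<comment> \<open>For 2 by 2 matrices in characteristic 2, \<open>u = 0\<close> suffices: a
      quadratic is separable once its linear coefficient is nonzero. Both linear coefficients and
      both constant terms are kept nonzero.\<close>
    obtain g1 where g1: "g1 \<noteq> 0" "g1 \<noteq> a 1" using exists_not_in_two[OF q] by blast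
    obtain f0 where f0: "f0 \<noteq> 0" "f0 \<noteq> be * a 0" using exists_not_in_two[OF q] by blast
    have sep: "ok [:c0, c1, 1:]" if "c0 \<noteq> 0" "c1 \<noteq> 0" for c0 c1
    proof -
      have "(2 :: 'a poly) = 0" using True by (simp add: numeral_poly)
      then have "separable [:c0, c1, 1:]"
        by (intro separable_of_pderiv_monom_mult_linear[where k = 0 and a = 0 and b = c1])
          (use that in \<open>auto simp: pderiv_pCons numeral_2_eq_2\<close>)
      then show ?thesis using True that by (simp add: ok_def)
    qed
    define f where "f = [:f0, a 1 - g1, 1:]"
    define g where "g = [:ga * (a 0 - f0 / be), g1, 1:]"
    have "a 0 - f0 / be \<noteq> 0" using f0(2) be by (auto simp: field_simps)
    then have "ok g" unfolding g_def using g1 ga by (intro sep) simp_all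
    moreover have "ok f" unfolding f_def using f0 g1 by (intro sep) simp_all
    moreover have "hess_mat m 1 (\<lambda>_. 0) a = hess_mat m be (\<lambda>_. 0) (coeff f) + hess_mat m ga (\<lambda>_. 0) (coeff g)"
      by (rule hess_mat_add) (use True be ga in \<open>auto simp: f_def g_def\<close>)
    ultimately show ?thesis using * by blast
  next
    case False
    obtain e where e: "\<And>t. \<exists>f. ok f \<and> coeff f (Suc m) = t \<and> coeff f m = (e :: 'a)"
    proof -
      have "\<exists>e :: 'a. \<forall>t. \<exists>f. monic f \<and> degree f = Suc (Suc m) \<and> separable f \<and> poly f 0 \<noteq> 0 \<and>
        coeff f (Suc (Suc m) - 1) = t \<and> coeff f (Suc (Suc m) - 2) = e"
        by (rule exists_separable_two_coeffs[OF q]) (use False in auto)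
      then obtain e :: 'a where "\<forall>t. \<exists>f. ok f \<and> coeff f (Suc m) = t \<and> coeff f m = e"
        by (auto simp: ok_def)
      then show thesis using that by blast
    qed
    \<comment> \<open>The value that \<open>u m\<close> will take. It involves \<open>f\<close> and
      \<open>g\<close> only through their common second coefficient \<open>e\<close>, so it is known
      before their traces are fixed and there is no circularity.\<close>
    define s where "s = a m - e / be - e / ga"
    \<comment> \<open>Solves \<open>(- a (Suc m) - s) - (- t - s) / ga = 1\<close> for the
      coefficient \<open>t\<close> of \<open>g\<close>.\<close>
    define t where "t = ga + ga * a (Suc m) - be * s"
    obtain g where g: "ok g" "coeff g (Suc m) = t" "coeff g m = e" using e by blast
    obtain f where f: "ok f" "coeff f (Suc m) = a (Suc m) - t" "coeff f m = e" using e by blast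
    define u where "u i = a i - coeff f i / be ^ (Suc m - i) - coeff g i / ga ^ (Suc m - i)" for i
    have um: "u m = s" using f g by (simp add: u_def s_def)
    have "be * s + ga * s = s" by (metis distrib_right ga(1) mult_1)
    then have "(- a (Suc m) - s) - (- t - s) / ga = 1"
      using ga(2) by (simp add: t_def field_simps)
    then have "hess_mat m 1 u a = hess_mat m be (\<lambda>_. 0) (coeff f) + hess_mat m ga u (coeff g)"
      by (intro hess_mat_add) (use be ga f g um in \<open>auto simp: u_def\<close>)
    then show ?thesis using *[OF f(1) g(1)] by blast
  qed
qed

lemma two_tame_companion:
  fixes M :: "'a :: {field, finite} mat"
  assumes q: "CARD('a) \<ge> 3" and M: "M \<in> carrier_mat n n" and n: "n > 0"
    and comp: "\<And>i j. i < n \<Longrightarrow> Suc j < n \<Longrightarrow> M $$ (i, j) = (if i = Suc j then 1 else 0)"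
  shows "two_tame n M"
proof (cases "n = 1")
  case True
  have tame: "tame_mat (mat 1 1 (\<lambda>_. b))" if "b \<noteq> 0" for b :: 'a
  \<comment> \<open>A 1 by 1 matrix is multiplication by X on K[X]/(X - b).\<close>
  proof (rule tame_mat_of_mult_X[where w = "\<lambda>_. 1" and f = "[:- b, 1:]" and n = 1])
    show "separable [:- b, 1:]"
      by (rule separable_of_pderiv_monom_mult_linear[where k = 0 and a = 0 and b = 1])
        (use that in \<open>auto simp: pderiv_pCons\<close>)
    fix j :: nat assume "j < 1"
    then have "[:0, 1:] * 1 - (\<Sum>i<1. Polynomial.smult (mat 1 1 (\<lambda>_. b) $$ (i, j)) 1) = [:- b, 1:]"
      by simp
    then show "[:- b, 1:] dvd [:0, 1:] * 1 - (\<Sum>i<1. Polynomial.smult (mat 1 1 (\<lambda>_. b) $$ (i, j)) 1)"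
      by (simp only: dvd_refl)
  qed (use that in simp_all)
  obtain b where "b \<noteq> 0" "b \<noteq> M $$ (0, 0)" using exists_not_in_two[OF q] by blast
  then have "tame_mat (mat 1 1 (\<lambda>_. b))" "tame_mat (mat 1 1 (\<lambda>_. M $$ (0, 0) - b))"
    by (intro tame; simp)+
  moreover have "M = mat 1 1 (\<lambda>_. b) + mat 1 1 (\<lambda>_. M $$ (0, 0) - b)"
    by (rule eq_matI) (use M True in auto)
  ultimately show ?thesis unfolding two_tame_def True
    by (intro exI[of _ "mat 1 1 (\<lambda>_. b)"] exI[of _ "mat 1 1 (\<lambda>_. M $$ (0, 0) - b)"] conjI mat_carrier)
next
  case False
  then obtain m where m: "n = Suc (Suc m)" using n by (cases n; cases "n - 1") auto
  let ?a = "\<lambda>i. - (M $$ (i, Suc m))"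
  have eq: "M = hess_mat m 1 (\<lambda>_. 0) ?a"
  proof (rule eq_matI)
    fix i j assume "i < dim_row (hess_mat m 1 (\<lambda>_. 0) ?a)" "j < dim_col (hess_mat m 1 (\<lambda>_. 0) ?a)"
    then have ij: "i < n" "j < n" by (auto simp: hess_mat_def m)
    show "M $$ (i, j) = hess_mat m 1 (\<lambda>_. 0) ?a $$ (i, j)"
    proof (cases "j = Suc m")
      case True
      then show ?thesis using ij m by (simp add: hess_mat_def hess_last_def)
    next
      case False
      then show ?thesis using ij m comp[of i j] by (simp add: hess_mat_def)
    qed
  qed (use M m in \<open>auto simp: hess_mat_def\<close>)
  obtain u where u: "two_tame (Suc (Suc m)) (hess_mat m 1 u ?a)"
    using two_tame_hess_mat_exists[OF q] by blast
  have "two_tame (Suc (Suc m)) (hess_mat m 1 (\<lambda>_. 0) ?a)"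
    unfolding hess_mat_conjugate[of m ?a u]
    by (rule two_tame_similar[OF last_col_mat_carrier last_col_mat_carrier last_col_mat_inverse hess_mat_carrier u])
  then show ?thesis unfolding m by (subst eq)
qed


section \<open>Biorthogonal systems and complements\<close>

text \<open>If k exceeded n, padding with zeros would give square matrices with product 1; the
  reversed product would be 1 too, yet it has a zero row.\<close>

lemma left_invertible_dim_le:
  fixes P Q :: "'a :: field mat"
  assumes P: "P \<in> carrier_mat n k" and Q: "Q \<in> carrier_mat k n" and QP: "Q * P = 1\<^sub>m k"
  shows "k \<le> n"
proof (rule ccontr)
  assume nk: "\<not> k \<le> n"
  define P' where "P' = mat k k (\<lambda>(i, j). if i < n then P $$ (i, j) else 0)"
  define Q' where "Q' = mat k k (\<lambda>(i, j). if j < n then Q $$ (i, j) else 0)"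
  have c: "P' \<in> carrier_mat k k" "Q' \<in> carrier_mat k k" by (auto simp: P'_def Q'_def)
  have "Q' * P' = 1\<^sub>m k"
  proof (rule eq_matI)
    fix i j assume "i < dim_row (1\<^sub>m k :: 'a mat)" "j < dim_col (1\<^sub>m k :: 'a mat)"
    then have ij: "i < k" "j < k" by auto
    have "(Q' * P') $$ (i, j) = (\<Sum>l<k. Q' $$ (i, l) * P' $$ (l, j))"
      by (rule index_mult_mat_sum[OF ij c(2,1)])
    also have "\<dots> = (\<Sum>l<n. Q $$ (i, l) * P $$ (l, j))"
      using nk ij by (intro sum.mono_neutral_cong_right) (auto simp: P'_def Q'_def)
    also have "\<dots> = (Q * P) $$ (i, j)" by (rule index_mult_mat_sum[OF ij Q P, symmetric])
    finally show "(Q' * P') $$ (i, j) = 1\<^sub>m k $$ (i, j)" unfolding QP .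
  qed (use c in auto)
  then have one: "P' * Q' = 1\<^sub>m k" by (rule mat_mult_left_right_inverse[OF c(2,1)])
  have "(P' * Q') $$ (n, n) = (\<Sum>l<k. P' $$ (n, l) * Q' $$ (l, n))"
    by (rule index_mult_mat_sum[OF _ _ c]) (use nk in auto)
  also have "\<dots> = 0" using nk by (intro sum.neutral) (auto simp: P'_def)
  finally show False using nk unfolding one by simp
qed

text \<open>\<open>F = 1 - P * Q\<close> is an idempotent with \<open>Q * F = 0\<close> and
  \<open>F * P = 0\<close>, nonzero because k < n. A column and a row of \<open>F\<close> through a
  nonzero entry, the row divided by that entry, extend the system; \<open>F * F = F\<close> makes
  their pairing 1.\<close>

lemma biorthogonal_extend:
  fixes P Q :: "'a :: field mat"
  assumes P: "P \<in> carrier_mat n k" and Q: "Q \<in> carrier_mat k n" and QP: "Q * P = 1\<^sub>m k" and k: "k < n"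
  shows "\<exists>P' Q'. P' \<in> carrier_mat n (Suc k) \<and> Q' \<in> carrier_mat (Suc k) n \<and> Q' * P' = 1\<^sub>m (Suc k) \<and>
    (\<forall>i<n. \<forall>j<k. P' $$ (i, j) = P $$ (i, j)) \<and> (\<forall>i<k. \<forall>j<n. Q' $$ (i, j) = Q $$ (i, j))"
proof -
  define F where "F = 1\<^sub>m n - P * Q"
  have F: "F \<in> carrier_mat n n" using P Q unfolding F_def by (intro minus_carrier_mat) auto
  have QF: "Q * F = 0\<^sub>m k n"
  proof -
    have "Q * F = Q * 1\<^sub>m n - Q * (P * Q)" unfolding F_def
      using P Q by (intro mult_minus_distrib_mat) auto
    also have "Q * (P * Q) = Q" using P Q QP by (simp flip: assoc_mult_mat[of _ k n _ k _ n])
    finally show ?thesis using Q by simp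
  qed
  have FP: "F * P = 0\<^sub>m n k"
  proof -
    have "F * P = 1\<^sub>m n * P - P * Q * P" unfolding F_def
      using P Q by (intro minus_mult_distrib_mat) auto
    also have "P * Q * P = P" using P Q QP by (simp add: assoc_mult_mat[of _ n k _ n _ k])
    finally show ?thesis using P by simp
  qed
  have FF: "F * F = F"
  proof -
    have "F * F = F * 1\<^sub>m n - F * (P * Q)" unfolding F_def
      using P Q by (intro mult_minus_distrib_mat) auto
    also have "F * (P * Q) = 0\<^sub>m n n" using P Q F FP by (simp flip: assoc_mult_mat[of _ n n _ k _ n])
    finally show ?thesis using F by (intro eq_matI) auto
  qed
  have "P * Q \<noteq> 1\<^sub>m n" using left_invertible_dim_le[OF Q P] k by auto
  have "\<exists>r<n. \<exists>c<n. F $$ (r, c) \<noteq> 0"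
  proof (rule ccontr)
    assume "\<not> ?thesis"
    then have "P * Q = 1\<^sub>m n" using P Q by (intro eq_matI) (auto simp: F_def)
    with \<open>P * Q \<noteq> 1\<^sub>m n\<close> show False ..
  qed
  then obtain r c where rc: "r < n" "c < n" "F $$ (r, c) \<noteq> 0" by blast
  define P' where "P' = mat n (Suc k) (\<lambda>(i, j). if j < k then P $$ (i, j) else F $$ (i, c))"
  define Q' where "Q' = mat (Suc k) n (\<lambda>(i, j). if i < k then Q $$ (i, j) else F $$ (r, j) / F $$ (r, c))"
  have c: "P' \<in> carrier_mat n (Suc k)" "Q' \<in> carrier_mat (Suc k) n" by (auto simp: P'_def Q'_def)
  have "Q' * P' = 1\<^sub>m (Suc k)"
  proof (rule eq_matI)
    fix i j assume "i < dim_row (1\<^sub>m (Suc k) :: 'a mat)" "j < dim_col (1\<^sub>m (Suc k) :: 'a mat)"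
    then have ij: "i < Suc k" "j < Suc k" by auto
    have "(Q' * P') $$ (i, j) = (\<Sum>l<n. Q' $$ (i, l) * P' $$ (l, j))"
      by (rule index_mult_mat_sum[OF ij c(2,1)])
    also have "\<dots> = (if i < k then if j < k then (Q * P) $$ (i, j) else (Q * F) $$ (i, c)
      else if j < k then (F * P) $$ (r, j) / F $$ (r, c) else (F * F) $$ (r, c) / F $$ (r, c))"
      using ij rc index_mult_mat_sum[OF _ _ Q P, of i j] index_mult_mat_sum[OF _ _ Q F, of i c]
        index_mult_mat_sum[OF _ _ F P, of r j] index_mult_mat_sum[OF _ _ F F, of r c]
      by (auto simp: P'_def Q'_def sum_divide_distrib)
    also have "\<dots> = 1\<^sub>m (Suc k) $$ (i, j)"
      unfolding QP QF FP FF using ij rc by (auto simp: less_Suc_eq)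
    finally show "(Q' * P') $$ (i, j) = 1\<^sub>m (Suc k) $$ (i, j)" .
  qed (use c in auto)
  with c show ?thesis by (intro exI[of _ P'] exI[of _ Q']) (auto simp: P'_def Q'_def)
qed

lemma biorthogonal_complete:
  fixes P Q :: "'a :: field mat"
  assumes P: "P \<in> carrier_mat n d" and Q: "Q \<in> carrier_mat d n" and QP: "Q * P = 1\<^sub>m d"
  shows "\<exists>P' Q'. P' \<in> carrier_mat n n \<and> Q' \<in> carrier_mat n n \<and> Q' * P' = 1\<^sub>m n \<and>
    (\<forall>i<n. \<forall>j<d. P' $$ (i, j) = P $$ (i, j)) \<and> (\<forall>i<d. \<forall>j<n. Q' $$ (i, j) = Q $$ (i, j))"
proof -
  have "d \<le> k \<Longrightarrow> k \<le> n \<Longrightarrow> \<exists>P' Q'. P' \<in> carrier_mat n k \<and> Q' \<in> carrier_mat k n \<and> Q' * P' = 1\<^sub>m k \<and>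
    (\<forall>i<n. \<forall>j<d. P' $$ (i, j) = P $$ (i, j)) \<and> (\<forall>i<d. \<forall>j<n. Q' $$ (i, j) = Q $$ (i, j))" for k
  proof (induction k rule: dec_induct)
    case base
    then show ?case using assms by blast
  next
    case (step k)
    then obtain P1 Q1 where 1: "P1 \<in> carrier_mat n k" "Q1 \<in> carrier_mat k n" "Q1 * P1 = 1\<^sub>m k"
      "\<forall>i<n. \<forall>j<d. P1 $$ (i, j) = P $$ (i, j)" "\<forall>i<d. \<forall>j<n. Q1 $$ (i, j) = Q $$ (i, j)"
      by auto
    obtain P2 Q2 where "P2 \<in> carrier_mat n (Suc k)" "Q2 \<in> carrier_mat (Suc k) n" "Q2 * P2 = 1\<^sub>m (Suc k)"
      "\<forall>i<n. \<forall>j<k. P2 $$ (i, j) = P1 $$ (i, j)" "\<forall>i<k. \<forall>j<n. Q2 $$ (i, j) = Q1 $$ (i, j)"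
      using biorthogonal_extend[OF 1(1-3)] step by auto
    with 1 step.hyps show ?case by (intro exI[of _ P2] exI[of _ Q2]) auto
  qed
  then show ?thesis using left_invertible_dim_le[OF assms] by blast
qed

text \<open>After completion to mutually inverse square matrices, the added columns and rows are
  \<open>N\<close> and \<open>R\<close>.\<close>

lemma exists_direct_sum_mat:
  fixes P Q :: "'a :: field mat"
  assumes P: "P \<in> carrier_mat n d" and Q: "Q \<in> carrier_mat d n" and QP: "Q * P = 1\<^sub>m d"
  shows "\<exists>N R. direct_sum_mat n d (n - d) P N Q R"
proof -
  obtain P' Q' where P': "P' \<in> carrier_mat n n" and Q': "Q' \<in> carrier_mat n n" and one: "Q' * P' = 1\<^sub>m n"
    and eq: "\<And>i j. i < n \<Longrightarrow> j < d \<Longrightarrow> P' $$ (i, j) = P $$ (i, j)"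
      "\<And>i j. i < d \<Longrightarrow> j < n \<Longrightarrow> Q' $$ (i, j) = Q $$ (i, j)"
    using biorthogonal_complete[OF assms] by blast
  have d: "d \<le> n" by (rule left_invertible_dim_le[OF assms])
  have one': "P' * Q' = 1\<^sub>m n" by (rule mat_mult_left_right_inverse[OF Q' P' one])
  define N where "N = mat n (n - d) (\<lambda>(i, j). P' $$ (i, d + j))"
  define R where "R = mat (n - d) n (\<lambda>(i, j). Q' $$ (d + i, j))"
  have N: "N \<in> carrier_mat n (n - d)" and R: "R \<in> carrier_mat (n - d) n" by (auto simp: N_def R_def)
  have entry: "(\<Sum>l<n. Q' $$ (i, l) * P' $$ (l, j)) = (if i = j then 1 else 0)" if "i < n" "j < n" for i j
    using index_mult_mat_sum[OF that Q' P'] that unfolding one by simp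
  have "direct_sum_mat n d (n - d) P N Q R"
  proof
    show "R * N = 1\<^sub>m (n - d)"
    proof (rule eq_matI)
      fix i j assume "i < dim_row (1\<^sub>m (n - d) :: 'a mat)" "j < dim_col (1\<^sub>m (n - d) :: 'a mat)"
      then have ij: "i < n - d" "j < n - d" by auto
      then show "(R * N) $$ (i, j) = 1\<^sub>m (n - d) $$ (i, j)"
        using index_mult_mat_sum[OF ij R N] entry[of "d + i" "d + j"] by (simp add: R_def N_def)
    qed (use R N in auto)
    show "Q * N = 0\<^sub>m d (n - d)"
    proof (rule eq_matI)
      fix i j assume "i < dim_row (0\<^sub>m d (n - d) :: 'a mat)" "j < dim_col (0\<^sub>m d (n - d) :: 'a mat)"
      then have ij: "i < d" "j < n - d" by auto
      then show "(Q * N) $$ (i, j) = 0\<^sub>m d (n - d) $$ (i, j)"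
        using index_mult_mat_sum[OF ij Q N] entry[of i "d + j"] by (simp add: N_def eq)
    qed (use Q N in auto)
    show "R * P = 0\<^sub>m (n - d) d"
    proof (rule eq_matI)
      fix i j assume "i < dim_row (0\<^sub>m (n - d) d :: 'a mat)" "j < dim_col (0\<^sub>m (n - d) d :: 'a mat)"
      then have ij: "i < n - d" "j < d" by auto
      then show "(R * P) $$ (i, j) = 0\<^sub>m (n - d) d $$ (i, j)"
        using index_mult_mat_sum[OF ij R P] entry[of "d + i" j] by (simp add: R_def eq[symmetric])
    qed (use R P in auto)
    show "P * Q + N * R = 1\<^sub>m n"
    proof (rule eq_matI)
      fix i j assume "i < dim_row (1\<^sub>m n :: 'a mat)" "j < dim_col (1\<^sub>m n :: 'a mat)"
      then have ij: "i < n" "j < n" by auto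
      have split: "(\<Sum>l<d + e. g l) = (\<Sum>l<d. g l) + (\<Sum>l<e. g (d + l))" for e and g :: "nat \<Rightarrow> 'a"
        by (induction e) (auto simp: add.assoc)
      have "(P' * Q') $$ (i, j) = (\<Sum>l<d + (n - d). P' $$ (i, l) * Q' $$ (l, j))"
        using index_mult_mat_sum[OF ij P' Q'] d by simp
      also have "\<dots> = (P * Q) $$ (i, j) + (N * R) $$ (i, j)"
        unfolding split index_mult_mat_sum[OF ij P Q] index_mult_mat_sum[OF ij N R]
        using ij by (auto simp: eq N_def R_def)
      finally show "(P * Q + N * R) $$ (i, j) = 1\<^sub>m n $$ (i, j)"
        using ij P Q N R unfolding one' by simp
    qed (use P Q N R in auto)
  qed (use P Q QP N R in auto)
  then show ?thesis by blast
qed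


section \<open>Krylov spaces and splitting off a cyclic summand\<close>

lemma index_mult_mat_vec_sum:
  assumes "i < n" "A \<in> carrier_mat n m" "v \<in> carrier_vec m"
  shows "(A *\<^sub>v v) $ i = (\<Sum>l<m. A $$ (i, l) * v $ l)"
  using assms by (simp add: scalar_prod_def atLeast0LessThan)

text \<open>In contrast to \<open>biorthogonal_extend\<close> the new column \<open>w\<close> is
  prescribed; the inequality says that it lies outside the column span of \<open>P\<close>.\<close>

lemma biorthogonal_append:
  fixes P Q :: "'a :: field mat"
  assumes P: "P \<in> carrier_mat n d" and Q: "Q \<in> carrier_mat d n" and QP: "Q * P = 1\<^sub>m d"
    and w: "w \<in> carrier_vec n" and ne: "P *\<^sub>v (Q *\<^sub>v w) \<noteq> w"
  shows "\<exists>Q'. Q' \<in> carrier_mat (Suc d) n \<and>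
    Q' * mat n (Suc d) (\<lambda>(i, j). if j < d then P $$ (i, j) else w $ i) = 1\<^sub>m (Suc d)"
proof -
  define y where "y = w - P *\<^sub>v (Q *\<^sub>v w)"
  have "\<exists>r<n. y $ r \<noteq> 0"
  proof (rule ccontr)
    assume "\<not> ?thesis"
    then have "P *\<^sub>v (Q *\<^sub>v w) = w" using P Q w by (intro eq_vecI) (auto simp: y_def)
    with ne show False ..
  qed
  then obtain r where r: "r < n" "y $ r \<noteq> 0" by blast
  define E where "E = P * Q"
  have E: "E \<in> carrier_mat n n" using P Q by (simp add: E_def)
  have EP: "E * P = P" using P Q QP by (simp add: E_def assoc_mult_mat[of _ n d _ n _ d])
  have Ew: "P *\<^sub>v (Q *\<^sub>v w) = E *\<^sub>v w" using P Q w by (simp add: E_def)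
  \<comment> \<open>A functional that kills the columns of \<open>P\<close> and takes the value 1 at
    \<open>w\<close>: row r of the projection \<open>1 - E\<close>, normalised. The rows of
    \<open>Q\<close> are then corrected by multiples of it.\<close>
  define psi where "psi l = ((if l = r then 1 else 0) - E $$ (r, l)) / y $ r" for l
  have psiP: "(\<Sum>l<n. psi l * P $$ (l, j)) = 0" if "j < d" for j
  proof -
    have "(\<Sum>l<n. psi l * P $$ (l, j)) = (\<Sum>l<n. (if l = r then P $$ (l, j) else 0) - E $$ (r, l) * P $$ (l, j)) / y $ r"
      unfolding psi_def sum_divide_distrib by (intro sum.cong) (auto simp: left_diff_distrib)
    also have "\<dots> = (P $$ (r, j) - (E * P) $$ (r, j)) / y $ r"
      using r index_mult_mat_sum[OF r(1) that E P] by (simp add: sum_subtractf)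
    finally show ?thesis unfolding EP by simp
  qed
  have psiw: "(\<Sum>l<n. psi l * w $ l) = 1"
  proof -
    have "(\<Sum>l<n. psi l * w $ l) = (\<Sum>l<n. (if l = r then w $ l else 0) - E $$ (r, l) * w $ l) / y $ r"
      unfolding psi_def sum_divide_distrib by (intro sum.cong) (auto simp: left_diff_distrib)
    also have "\<dots> = (w $ r - (E *\<^sub>v w) $ r) / y $ r"
      using r E w by (simp add: sum_subtractf scalar_prod_def atLeast0LessThan)
    also have "w $ r - (E *\<^sub>v w) $ r = y $ r" using r E w by (simp add: y_def Ew)
    finally show ?thesis using r by simp
  qed
  define P' where "P' = mat n (Suc d) (\<lambda>(i, j). if j < d then P $$ (i, j) else w $ i)"
  define Q' where "Q' = mat (Suc d) n (\<lambda>(i, j). if i < d then Q $$ (i, j) - (Q *\<^sub>v w) $ i * psi j else psi j)"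
  have c: "P' \<in> carrier_mat n (Suc d)" "Q' \<in> carrier_mat (Suc d) n" by (auto simp: P'_def Q'_def)
  have "Q' * P' = 1\<^sub>m (Suc d)"
  proof (rule eq_matI)
    fix i j assume "i < dim_row (1\<^sub>m (Suc d) :: 'a mat)" "j < dim_col (1\<^sub>m (Suc d) :: 'a mat)"
    then have ij: "i < Suc d" "j < Suc d" by auto
    define p where "p l = (if j < d then P $$ (l, j) else w $ l)" for l
    have pp: "(\<Sum>l<n. psi l * p l) = (if j < d then 0 else 1)"
      using psiP psiw by (auto simp: p_def)
    have "(Q' * P') $$ (i, j) = (\<Sum>l<n. Q' $$ (i, l) * P' $$ (l, j))"
      by (rule index_mult_mat_sum[OF ij c(2,1)])
    also have "\<dots> = (\<Sum>l<n. (if i < d then Q $$ (i, l) - (Q *\<^sub>v w) $ i * psi l else psi l) * p l)"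
      using ij by (intro sum.cong) (auto simp: P'_def Q'_def p_def)
    also have "\<dots> = (if i < d then (\<Sum>l<n. Q $$ (i, l) * p l) - (Q *\<^sub>v w) $ i * (\<Sum>l<n. psi l * p l)
      else (\<Sum>l<n. psi l * p l))"
      by (simp add: left_diff_distrib sum_subtractf sum_distrib_left mult.assoc)
    also have "\<dots> = 1\<^sub>m (Suc d) $$ (i, j)"
    proof (cases "i < d \<and> j < d")
      case True
      then have "(\<Sum>l<n. Q $$ (i, l) * p l) = (Q * P) $$ (i, j)"
        using index_mult_mat_sum[OF _ _ Q P, of i j] by (simp add: p_def)
      then show ?thesis using True ij by (simp add: pp QP)
    next
      case False
      have "(\<Sum>l<n. Q $$ (i, l) * w $ l) = (Q *\<^sub>v w) $ i" if "i < d"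
        using that Q w by (simp add: scalar_prod_def atLeast0LessThan)
      then show ?thesis using False ij pp by (auto simp: p_def less_Suc_eq)
    qed
    finally show "(Q' * P') $$ (i, j) = 1\<^sub>m (Suc d) $$ (i, j)" .
  qed (use c in auto)
  then show ?thesis using c(2) unfolding P'_def by blast
qed

definition krylov :: "'a :: field mat \<Rightarrow> 'a vec \<Rightarrow> nat \<Rightarrow> 'a mat" where
  "krylov A v d = mat (dim_row A) d (\<lambda>(i, j). (A ^\<^sub>m j *\<^sub>v v) $ i)"

text \<open>Linear independence of v, Av, ..., A^(d-1)v for some v, encoded by a left inverse so
  that the biorthogonal lemmas apply directly.\<close>

definition krylov_indep :: "'a :: field mat \<Rightarrow> nat \<Rightarrow> bool" where
  "krylov_indep A d \<longleftrightarrow> (\<exists>v Q. v \<in> carrier_vec (dim_row A) \<and> Q \<in> carrier_mat d (dim_row A) \<and>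
     Q * krylov A v d = 1\<^sub>m d)"

lemma krylov_carrier: "A \<in> carrier_mat n n \<Longrightarrow> krylov A v d \<in> carrier_mat n d"
  by (simp add: krylov_def)

lemma mult_krylov_index:
  assumes A: "A \<in> carrier_mat n n" and v: "v \<in> carrier_vec n" and ij: "i < n" "j < d"
  shows "(A * krylov A v d) $$ (i, j) = (A ^\<^sub>m Suc j *\<^sub>v v) $ i"
proof -
  have Aj: "A ^\<^sub>m j \<in> carrier_mat n n" using A by simp
  have "(A * krylov A v d) $$ (i, j) = (\<Sum>l<n. A $$ (i, l) * (A ^\<^sub>m j *\<^sub>v v) $ l)"
    using A ij by (subst index_mult_mat_sum[OF ij A krylov_carrier[OF A]]) (simp add: krylov_def)
  also have "\<dots> = (A *\<^sub>v (A ^\<^sub>m j *\<^sub>v v)) $ i"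
    using A Aj v ij by (simp add: scalar_prod_def atLeast0LessThan)
  also have "A *\<^sub>v (A ^\<^sub>m j *\<^sub>v v) = A ^\<^sub>m Suc j *\<^sub>v v"
    unfolding pow_mat_Suc_left[OF A] using A Aj v by (rule assoc_mult_mat_vec[symmetric])
  finally show ?thesis .
qed

text \<open>By maximality the next Krylov vector lies in the span of the first d, so the span is
  invariant; \<open>krylov A v d * Q\<close> is a projection onto it and fixes the image under
  \<open>A\<close>.\<close>

lemma krylov_invariant:
  assumes A: "A \<in> carrier_mat n n" and v: "v \<in> carrier_vec n" and Q: "Q \<in> carrier_mat d n"
    and QP: "Q * krylov A v d = 1\<^sub>m d" and max: "\<not> krylov_indep A (Suc d)"
  shows "krylov A v d * (Q * (A * krylov A v d)) = A * krylov A v d"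
proof -
  define P where "P = krylov A v d"
  note QP = QP[folded P_def]
  have P: "P \<in> carrier_mat n d" using A by (simp add: P_def krylov_carrier)
  have AP: "A * P \<in> carrier_mat n d" using A P by simp
  have w: "A ^\<^sub>m d *\<^sub>v v \<in> carrier_vec n" using A v by (intro mult_mat_vec_carrier[of _ n n]) auto
  have fix_last: "P *\<^sub>v (Q *\<^sub>v (A ^\<^sub>m d *\<^sub>v v)) = A ^\<^sub>m d *\<^sub>v v"
  proof (rule ccontr)
    assume "\<not> ?thesis"
    from biorthogonal_append[OF P Q QP w this] obtain Q' where
      "Q' \<in> carrier_mat (Suc d) n"
      "Q' * mat n (Suc d) (\<lambda>(i, j). if j < d then P $$ (i, j) else (A ^\<^sub>m d *\<^sub>v v) $ i) = 1\<^sub>m (Suc d)"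
      by blast
    moreover have "mat n (Suc d) (\<lambda>(i, j). if j < d then P $$ (i, j) else (A ^\<^sub>m d *\<^sub>v v) $ i) = krylov A v (Suc d)"
      by (rule eq_matI) (use A in \<open>auto simp: P_def krylov_def less_Suc_eq\<close>)
    ultimately have "krylov_indep A (Suc d)" using A v by (auto simp: krylov_indep_def)
    with max show False ..
  qed
  define E where "E = P * Q"
  have E: "E \<in> carrier_mat n n" using P Q by (simp add: E_def)
  have EP: "E * P = P" using P Q QP by (simp add: E_def assoc_mult_mat[of _ n d _ n _ d])
  have "E * (A * P) = A * P"
  proof (rule eq_matI)
    fix i j assume "i < dim_row (A * P)" "j < dim_col (A * P)"
    then have ij: "i < n" "j < d" using A P by auto
    have "(E * (A * P)) $$ (i, j) = (\<Sum>l<n. E $$ (i, l) * (A ^\<^sub>m Suc j *\<^sub>v v) $ l)"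
      unfolding index_mult_mat_sum[OF ij E AP] unfolding P_def
      by (intro sum.cong refl arg_cong[of _ _ "(*) _"] mult_krylov_index[OF A v]) (use ij in auto)
    also have "\<dots> = (A ^\<^sub>m Suc j *\<^sub>v v) $ i"
    proof (cases "Suc j = d")
      case True
      have "(\<Sum>l<n. E $$ (i, l) * (A ^\<^sub>m Suc j *\<^sub>v v) $ l) = (E *\<^sub>v (A ^\<^sub>m d *\<^sub>v v)) $ i"
        unfolding True by (rule index_mult_mat_vec_sum[OF ij(1) E w, symmetric])
      also have "E *\<^sub>v (A ^\<^sub>m d *\<^sub>v v) = A ^\<^sub>m d *\<^sub>v v" using fix_last P Q w by (simp add: E_def)
      finally show ?thesis using True by simp
    next
      case False
      then have j: "Suc j < d" using ij by simp
      have "(\<Sum>l<n. E $$ (i, l) * (A ^\<^sub>m Suc j *\<^sub>v v) $ l) = (\<Sum>l<n. E $$ (i, l) * P $$ (l, Suc j))"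
        using j A by (intro sum.cong) (auto simp: P_def krylov_def)
      also have "\<dots> = (E * P) $$ (i, Suc j)" by (rule index_mult_mat_sum[OF ij(1) j E P, symmetric])
      also have "\<dots> = (A ^\<^sub>m Suc j *\<^sub>v v) $ i" unfolding EP using j ij A by (simp add: P_def krylov_def)
      finally show ?thesis .
    qed
    also have "\<dots> = (A * P) $$ (i, j)" unfolding P_def by (rule mult_krylov_index[OF A v ij, symmetric])
    finally show "(E * (A * P)) $$ (i, j) = (A * P) $$ (i, j)" .
  qed (use A P E in auto)
  then show ?thesis using P Q AP by (simp add: E_def P_def[symmetric] assoc_mult_mat[of _ n d _ n _ d])
qed

text \<open>A kernel vector vanishes by back substitution: row 0 kills its last entry, row 1 the one
  before it, and so on.\<close>

lemma det_antitriangular_nonzero: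
  fixes G :: "'a :: field mat"
  assumes G: "G \<in> carrier_mat d d"
    and one: "\<And>i j. i + j = d - 1 \<Longrightarrow> i < d \<Longrightarrow> j < d \<Longrightarrow> G $$ (i, j) = 1"
    and zero: "\<And>i j. i + j < d - 1 \<Longrightarrow> i < d \<Longrightarrow> j < d \<Longrightarrow> G $$ (i, j) = 0"
  shows "det G \<noteq> 0"
proof
  assume "det G = 0"
  then obtain x where x: "x \<in> carrier_vec d" "x \<noteq> 0\<^sub>v d" "G *\<^sub>v x = 0\<^sub>v d"
    using det_0_iff_vec_prod_zero_field[OF G] by blast
  have "x $ (d - 1 - i) = 0" if "i < d" for i
    using that
  proof (induction i rule: less_induct)
    case (less i)
    have "0 = (G *\<^sub>v x) $ i" using x less.prems by simp
    also have "\<dots> = (\<Sum>j<d. G $$ (i, j) * x $ j)"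
      by (rule index_mult_mat_vec_sum[OF less.prems G x(1)])
    also have "\<dots> = (\<Sum>j<d. if j = d - 1 - i then x $ j else 0)"
    proof (intro sum.cong refl)
      fix j assume "j \<in> {..<d}"
      then have j: "j < d" by simp
      consider "i + j < d - 1" | "i + j = d - 1" | "i + j > d - 1" by linarith
      then show "G $$ (i, j) * x $ j = (if j = d - 1 - i then x $ j else 0)"
      proof cases
        case 3
        then have "x $ (d - 1 - (d - 1 - j)) = 0" using j less.prems by (intro less.IH) auto
        then show ?thesis using j by auto
      qed (use one[of i j] zero[of i j] less.prems j in auto)
    qed
    also have "\<dots> = x $ (d - 1 - i)" using less.prems by simp
    finally show ?case by simp
  qed
  note zero_entry = this
  have "x $ j = 0" if "j < d" for j using zero_entry[of "d - 1 - j"] that by simp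
  then have "x = 0\<^sub>v d" using x by (intro eq_vecI) auto
  with x show False by simp
qed


text \<open>Moving powers of \<open>A\<close> across the pairing shows that the Gram matrix of the
  two Krylov families is a Hankel matrix.\<close>

lemma krylov_pairing:
  fixes A :: "'a :: field mat"
  assumes A: "A \<in> carrier_mat n n" and v: "v \<in> carrier_vec n" and u: "u \<in> carrier_vec n"
    and ij: "i < d" "j < d"
  shows "((krylov A\<^sup>T u d)\<^sup>T * krylov A v d) $$ (i, j) = u \<bullet> (A ^\<^sub>m (i + j) *\<^sub>v v)"
proof -
  have c: "A ^\<^sub>m i \<in> carrier_mat n n" "A ^\<^sub>m j \<in> carrier_mat n n" using A by auto
  have cv: "A ^\<^sub>m j *\<^sub>v v \<in> carrier_vec n" using c v by simp
  have K: "(krylov A\<^sup>T u d)\<^sup>T \<in> carrier_mat d n" using A by (simp add: krylov_def)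
  have "((krylov A\<^sup>T u d)\<^sup>T * krylov A v d) $$ (i, j) = (\<Sum>l<n. ((A ^\<^sub>m i)\<^sup>T *\<^sub>v u) $ l * (A ^\<^sub>m j *\<^sub>v v) $ l)"
    unfolding index_mult_mat_sum[OF ij K krylov_carrier[OF A]]
    using A ij by (intro sum.cong) (auto simp: krylov_def pow_mat_transpose[OF A])
  also have "\<dots> = ((A ^\<^sub>m i)\<^sup>T *\<^sub>v u) \<bullet> (A ^\<^sub>m j *\<^sub>v v)"
    unfolding scalar_prod_def[of _ "A ^\<^sub>m j *\<^sub>v v"] using cv by (simp only: carrier_vecD atLeast0LessThan)
  also have "\<dots> = u \<bullet> (A ^\<^sub>m i *\<^sub>v (A ^\<^sub>m j *\<^sub>v v))"
    by (rule transpose_vec_mult_scalar[OF c(1) cv u])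
  also have "A ^\<^sub>m i *\<^sub>v (A ^\<^sub>m j *\<^sub>v v) = A ^\<^sub>m (i + j) *\<^sub>v v"
    unfolding pow_mat_add_exponent[OF A] using c v by (rule assoc_mult_mat_vec[symmetric])
  finally show ?thesis .
qed

text \<open>With \<open>d\<close> maximal both for \<open>A\<close> and for its transpose, the span of the columns of \<open>P\<close> and the
  common kernel of the rows of \<open>Q\<close> are complementary invariant subspaces. The rows are
  \<open>u, uA, \<dots>, uA\<^sup>d\<^sup>-\<^sup>1\<close> up to a change of basis, for a functional \<open>u\<close> that is dual to the last Krylov vector.\<close>

lemma krylov_maximal_splits:
  fixes A :: "'a :: field mat"
  assumes A: "A \<in> carrier_mat n n" and d: "d > 0" and ind: "krylov_indep A d"
    and max: "\<not> krylov_indep A (Suc d)" "\<not> krylov_indep A\<^sup>T (Suc d)"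
  shows "\<exists>P Q M. P \<in> carrier_mat n d \<and> Q \<in> carrier_mat d n \<and> M \<in> carrier_mat d d \<and> Q * P = 1\<^sub>m d \<and>
    A * P = P * M \<and> Q * A = M * Q \<and>
    (\<forall>i j. i < d \<longrightarrow> Suc j < d \<longrightarrow> M $$ (i, j) = (if i = Suc j then 1 else 0))"
proof -
  obtain v Q0 where v: "v \<in> carrier_vec n" and Q0: "Q0 \<in> carrier_mat d n" and Q0P: "Q0 * krylov A v d = 1\<^sub>m d"
    using ind A by (auto simp: krylov_indep_def)
  define P where "P = krylov A v d"
  have P: "P \<in> carrier_mat n d" using A by (simp add: P_def krylov_carrier)
  \<comment> \<open>As a row of the left inverse, \<open>u\<close> takes the value 1 at the last
    Krylov vector and 0 at the earlier ones.\<close>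
  define u where "u = row Q0 (d - 1)"
  have u: "u \<in> carrier_vec n" using Q0 row_carrier[of Q0 "d - 1"] by (simp add: u_def)
  have uv: "u \<bullet> (A ^\<^sub>m j *\<^sub>v v) = (if j = d - 1 then 1 else 0)" if j: "j < d" for j
  proof -
    have "col P j = A ^\<^sub>m j *\<^sub>v v" using A v j by (intro eq_vecI) (auto simp: P_def krylov_def)
    then have "u \<bullet> (A ^\<^sub>m j *\<^sub>v v) = (Q0 * P) $$ (d - 1, j)" using j d Q0 P by (simp add: u_def)
    then show ?thesis unfolding P_def Q0P using j d by auto
  qed
  define K where "K = krylov A\<^sup>T u d"
  have K: "K \<in> carrier_mat n d" using A by (simp add: K_def krylov_carrier)
  define G where "G = K\<^sup>T * P"
  have G: "G \<in> carrier_mat d d" using K P by (simp add: G_def)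
  have Gij: "G $$ (i, j) = u \<bullet> (A ^\<^sub>m (i + j) *\<^sub>v v)" if "i < d" "j < d" for i j
    unfolding G_def K_def P_def using A v u that by (rule krylov_pairing)
  \<comment> \<open>The Hankel matrix \<open>G\<close> has zeros above the antidiagonal and ones on
    it.\<close>
  have "det G \<noteq> 0"
    by (rule det_antitriangular_nonzero[OF G]) (use d in \<open>auto simp: Gij uv\<close>)
  then obtain H where H: "H \<in> carrier_mat d d" "H * G = 1\<^sub>m d" "G * H = 1\<^sub>m d"
    using det_non_zero_imp_unit[OF G, of "()"] by (auto simp: Units_def ring_mat_def)
  define Q where "Q = H * K\<^sup>T"
  have Q: "Q \<in> carrier_mat d n" using H K by (simp add: Q_def)
  have QP: "Q * P = 1\<^sub>m d"
  proof -
    have "Q * P = H * G" unfolding Q_def G_def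
      by (rule assoc_mult_mat[of _ d d _ n _ d]) (use H K P in auto)
    then show ?thesis using H by simp
  qed
  define M where "M = Q * (A * P)"
  have M: "M \<in> carrier_mat d d" using Q A P by (simp add: M_def)
  have AP: "A * P = P * M"
    unfolding M_def P_def by (rule krylov_invariant[OF A v Q QP[unfolded P_def] max(1), symmetric])
  \<comment> \<open>This left inverse of \<open>K\<close> allows \<open>krylov_invariant\<close> to
    be applied to the transpose; transposed back, it says that the row space of \<open>Q\<close> is
    invariant under \<open>A\<close>.\<close>
  have "(P * H)\<^sup>T * K = 1\<^sub>m d"
  proof -
    have "K\<^sup>T * (P * H) = G * H" unfolding G_def
      by (rule assoc_mult_mat[symmetric, of _ d n _ d _ d]) (use H K P in auto)
    then have "K\<^sup>T * (P * H) = 1\<^sub>m d" using H by simp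
    then have "(K\<^sup>T * (P * H))\<^sup>T = 1\<^sub>m d" by simp
    then show ?thesis using K P H by (subst (asm) transpose_mult[of _ d n _ d]) auto
  qed
  then have "K * ((P * H)\<^sup>T * (A\<^sup>T * K)) = A\<^sup>T * K"
    unfolding K_def by (intro krylov_invariant[of _ n]) (use A u P H max in auto)
  then have "(K * ((P * H)\<^sup>T * (A\<^sup>T * K)))\<^sup>T = (A\<^sup>T * K)\<^sup>T" by simp
  moreover have "(A\<^sup>T * K)\<^sup>T = K\<^sup>T * A" using A K by (subst transpose_mult[of _ n n _ d]) auto
  moreover have "(K * ((P * H)\<^sup>T * (A\<^sup>T * K)))\<^sup>T = K\<^sup>T * A * (P * H) * K\<^sup>T"
  proof -
    have c: "(P * H)\<^sup>T \<in> carrier_mat d n" "A\<^sup>T * K \<in> carrier_mat n d" using A K P H by auto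
    have "(K * ((P * H)\<^sup>T * (A\<^sup>T * K)))\<^sup>T = ((P * H)\<^sup>T * (A\<^sup>T * K))\<^sup>T * K\<^sup>T"
      by (rule transpose_mult[OF K mult_carrier_mat[OF c]])
    also have "((P * H)\<^sup>T * (A\<^sup>T * K))\<^sup>T = (A\<^sup>T * K)\<^sup>T * (P * H)"
      unfolding transpose_mult[OF c] by simp
    finally show ?thesis using \<open>(A\<^sup>T * K)\<^sup>T = K\<^sup>T * A\<close> by simp
  qed
  ultimately have KA: "K\<^sup>T * A = K\<^sup>T * A * (P * H) * K\<^sup>T" by simp
  have "Q * A = H * (K\<^sup>T * A)" using H K A by (simp add: Q_def assoc_mult_mat[of _ d d _ n _ n])
  also have "\<dots> = H * (K\<^sup>T * A * (P * H) * K\<^sup>T)" by (rule arg_cong[OF KA])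
  also have "\<dots> = H * (K\<^sup>T * (A * (P * (H * K\<^sup>T))))"
    using H K A P by (simp add: assoc_mult_mat[of _ d n _ n _ d] assoc_mult_mat[of _ d n _ d _ n] assoc_mult_mat[of _ d n _ n _ n]
        assoc_mult_mat[of _ n d _ d _ n] assoc_mult_mat[of _ n n _ d _ n])
  also have "\<dots> = (H * K\<^sup>T) * (A * (P * (H * K\<^sup>T)))"
    by (rule assoc_mult_mat[symmetric, of _ d d _ n _ n]) (use H K A P in auto)
  also have "\<dots> = Q * (A * (P * Q))" by (simp add: Q_def)
  also have "\<dots> = M * Q"
    using Q A P by (simp add: M_def assoc_mult_mat[of _ d n _ d _ n] assoc_mult_mat[of _ n n _ d _ n])
  finally have QA: "Q * A = M * Q" .
  \<comment> \<open>\<open>A\<close> sends each Krylov vector except the last to the next one, so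
    \<open>M\<close> is a companion matrix.\<close>
  have "M $$ (i, j) = (if i = Suc j then 1 else 0)" if ij: "i < d" "Suc j < d" for i j
  proof -
    have "M $$ (i, j) = (\<Sum>l<n. Q $$ (i, l) * (A * P) $$ (l, j))"
      unfolding M_def by (rule index_mult_mat_sum[where n = d and m = d]) (use ij Q A P in auto)
    also have "\<dots> = (\<Sum>l<n. Q $$ (i, l) * P $$ (l, Suc j))"
    proof (intro sum.cong refl arg_cong[of _ _ "(*) _"])
      fix l assume l: "l \<in> {..<n}"
      then have "(A * P) $$ (l, j) = (A ^\<^sub>m Suc j *\<^sub>v v) $ l"
        unfolding P_def using ij by (intro mult_krylov_index[OF A v]) auto
      also have "\<dots> = P $$ (l, Suc j)" using l ij A by (simp add: P_def krylov_def)
      finally show "(A * P) $$ (l, j) = P $$ (l, Suc j)" .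
    qed
    also have "\<dots> = (Q * P) $$ (i, Suc j)" by (rule index_mult_mat_sum[OF ij Q P, symmetric])
    finally show ?thesis using ij by (simp add: QP)
  qed
  with P Q M QP AP QA show ?thesis by blast
qed

section \<open>Induction on the size and the final theorem\<close>

text \<open>A cyclic summand of maximal dimension is split off as a companion block; the complement
  is smaller and falls under the induction hypothesis.\<close>

lemma two_tame_all:
  fixes A :: "'a :: {field, finite} mat"
  assumes q: "CARD('a) \<ge> 3" and "A \<in> carrier_mat n n"
  shows "two_tame n A"
  using assms(2)
proof (induction n arbitrary: A rule: less_induct)
  case (less n)
  note A = less.prems
  have step: "two_tame n A" if A: "A \<in> carrier_mat n n" and d: "d > 0" "krylov_indep A d"
    "\<not> krylov_indep A (Suc d)" "\<not> krylov_indep A\<^sup>T (Suc d)" for A :: "'a mat" and d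
  proof -
    obtain P Q M where P: "P \<in> carrier_mat n d" and Q: "Q \<in> carrier_mat d n" and M: "M \<in> carrier_mat d d"
      and QP: "Q * P = 1\<^sub>m d" and AP: "A * P = P * M" and QA: "Q * A = M * Q"
      and comp: "\<And>i j. i < d \<Longrightarrow> Suc j < d \<Longrightarrow> M $$ (i, j) = (if i = Suc j then 1 else 0)"
      using krylov_maximal_splits[OF A d] by blast
    obtain N R where "direct_sum_mat n d (n - d) P N Q R" using exists_direct_sum_mat[OF P Q QP] by blast
    then interpret direct_sum_mat n d "n - d" P N Q R .
    define M' where "M' = R * (A * N)"
    have M': "M' \<in> carrier_mat (n - d) (n - d)" using R A N by (simp add: M'_def)
    \<comment> \<open>The relation \<open>Q * A = M * Q\<close> makes the kernel of \<open>Q\<close>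
      invariant, and the columns of \<open>N\<close> lie in it.\<close>
    have QAN: "Q * (A * N) = 0\<^sub>m d (n - d)"
    proof -
      have "Q * (A * N) = Q * A * N" using Q A N by (rule assoc_mult_mat[symmetric])
      also have "\<dots> = M * (Q * N)" unfolding QA using M Q N by (rule assoc_mult_mat)
      finally show ?thesis using M by (simp add: QN)
    qed
    have "A * N = (P * Q + N * R) * (A * N)" using PQ_NR A N by simp
    also have "\<dots> = P * Q * (A * N) + N * R * (A * N)"
      using P Q N R A by (intro add_mult_distrib_mat) auto
    also have "P * Q * (A * N) = P * (Q * (A * N))" using P Q N A by (intro assoc_mult_mat) auto
    also have "\<dots> = 0\<^sub>m n (n - d)" unfolding QAN using P by simp
    also have "N * R * (A * N) = N * M'" unfolding M'_def using N R A by (intro assoc_mult_mat) auto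
    also have "0\<^sub>m n (n - d) + N * M' = N * M'" using N M' by simp
    finally have AN: "A * N = N * M'" .
    have eq: "A = P * M * Q + N * M' * R" using mult_left[OF A] unfolding AP AN .
    have "two_tame d M" by (rule two_tame_companion[OF q M d(1) comp])
    moreover have "two_tame (n - d) M'"
      using d(1) left_invertible_dim_le[OF P Q QP] M' by (intro less.IH) auto
    ultimately have "two_tame n (P * M * Q + N * M' * R)" by (rule two_tame_glue)
    then show ?thesis by (subst eq)
  qed
  show ?case
  proof (cases "n = 0")
    case True
    then have "A = 0\<^sub>m 0 0" using A by (intro eq_matI) auto
    then show ?thesis using two_tame_zero_dim True by simp
  next
    case False
    \<comment> \<open>Taking the maximum over \<open>A\<close> and its transpose together avoids
      comparing their two maxima. If only the transpose attains it, the splitting is done there and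
      transposed back.\<close>
    define S where "S = {d. krylov_indep A d \<or> krylov_indep A\<^sup>T d}"
    have bound: "d \<le> n" if ind: "krylov_indep B d" and B: "B \<in> carrier_mat n n" for B :: "'a mat" and d
      using ind B left_invertible_dim_le[OF krylov_carrier[OF B]] by (auto simp: krylov_indep_def)
    have "S \<subseteq> {..n}" using bound A by (auto simp: S_def)
    then have fin: "finite S" by (rule finite_subset) simp
    have "krylov_indep A 1"
    proof -
      let ?Q = "mat 1 n (\<lambda>(i, j). if j = 0 then 1 else 0) :: 'a mat"
      have "?Q * krylov A (unit_vec n 0) 1 = 1\<^sub>m 1"
      proof (rule eq_matI)
        fix i j assume "i < dim_row (1\<^sub>m 1 :: 'a mat)" "j < dim_col (1\<^sub>m 1 :: 'a mat)"
        then have ij: "i < 1" "j < 1" by auto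
        have "(?Q * krylov A (unit_vec n 0) 1) $$ (i, j) = (\<Sum>l<n. ?Q $$ (i, l) * krylov A (unit_vec n 0) 1 $$ (l, j))"
          by (rule index_mult_mat_sum[OF ij _ krylov_carrier[OF A]]) simp
        also have "\<dots> = (\<Sum>l<n. if l = 0 then 1 else 0)"
          using ij A False by (intro sum.cong) (auto simp: krylov_def)
        finally show "(?Q * krylov A (unit_vec n 0) 1) $$ (i, j) = 1\<^sub>m 1 $$ (i, j)" using ij False by simp
      qed (use A in \<open>auto simp: krylov_def\<close>)
      then show ?thesis using A unfolding krylov_indep_def
        by (intro exI[of _ "unit_vec n 0"] exI[of _ ?Q]) auto
    qed
    then have S1: "1 \<in> S" by (simp add: S_def)
    define d where "d = Max S"
    have "d \<in> S" unfolding d_def using fin S1 by (intro Max_in) auto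
    moreover have "d > 0" using Max_ge[OF fin S1] by (simp add: d_def)
    moreover have "Suc d \<notin> S" using Max_ge[OF fin, of "Suc d"] by (auto simp: d_def)
    ultimately have dS: "d \<in> S" "d > 0" "Suc d \<notin> S" .
    from dS(1) consider "krylov_indep A d" | "krylov_indep A\<^sup>T d" by (auto simp: S_def)
    then show ?thesis
    proof cases
      case 1
      then show ?thesis using step[OF A] dS by (auto simp: S_def)
    next
      case 2
      then have "two_tame n A\<^sup>T" using A dS by (intro step[of _ d]) (auto simp: S_def)
      then show ?thesis using two_tame_transpose[of n "A\<^sup>T"] by simp
    qed
  qed
qed

theorem theorem1p6:
  fixes A :: "'a :: {field, finite} mat" and n :: nat
  assumes "CARD('a) \<ge> 3"
    and "n \<ge> 2"
    and "A \<in> carrier_mat n n"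
  shows "(\<exists>B C. B \<in> carrier_mat n n \<and> C \<in> carrier_mat n n \<and>
            invertible_mat B \<and> cyclic_mat B \<and> invertible_mat C \<and> cyclic_mat C \<and> A = B + C)
       \<and> (\<exists>B C. B \<in> carrier_mat n n \<and> C \<in> carrier_mat n n \<and>
            invertible_mat B \<and> semisimple_mat B \<and> invertible_mat C \<and> semisimple_mat C \<and> A = B + C)"
proof
  show "\<exists>B C. B \<in> carrier_mat n n \<and> C \<in> carrier_mat n n \<and>
    invertible_mat B \<and> cyclic_mat B \<and> invertible_mat C \<and> cyclic_mat C \<and> A = B + C"
    by (rule sum_of_two_invertible_cyclic[OF assms(1,3)])
  obtain B C where "B \<in> carrier_mat n n" "C \<in> carrier_mat n n" "tame_mat B" "tame_mat C" "A = B + C"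
    using two_tame_all[OF assms(1,3)] by (auto simp: two_tame_def)
  then show "\<exists>B C. B \<in> carrier_mat n n \<and> C \<in> carrier_mat n n \<and>
    invertible_mat B \<and> semisimple_mat B \<and> invertible_mat C \<and> semisimple_mat C \<and> A = B + C"
    using tame_mat_invertible tame_mat_semisimple by blast
qed

end
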